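(* There are nontrivial monomial polyhedra $\mathcal U_B$ for which the Bergman projection $P_{\mathcal U_B}$ is not of restricted weak type $(p_*,p_* )$, where $p_*=\max_j\frac{2\,\mathbf 1a_j}{\mathbf 1a_j+1}$ is the left endpoint of the interval of those $p$ for which $P_{\mathcal U_B}$ is bounded on $L^p(\mathcal U_B)$.
   Context: Monomial polyhedron: for an integer matrix $B\in\mathbb Z^{n\times n}$ with entry $b^j_k$ in row $j$, column $k$, set $\mathcal U_B=\{z\in\mathbb C^n:\ \prod_{k=1}^n|z_k|^{b^j_k}<1\text{ for }1\le j\le n\}$ (a point is in the set only if all the powers are defined; $0^0=1$). It is called a monomial polyhedron if it is a bounded domain (connected open set) in $\mathbb C^n$, $n\ge2$. It is nontrivial if it is not the unit polydisc $\mathbb D^n$. The rows of $B$ are ordered so that $\det B>0$ (permuting rows does not change $\mathcal U_B$). Let $\Delta=\operatorname{adj}B=(\det B)B^{-1}$ (an integer matrix with nonnegative entries and nonzero determinant), with columns $\delta_1,\dots,\delta_n$, and let $a_j=\delta_j/\gcd(\delta_j)$, where $\gcd(\delta_j)$ is the gcd of the entries of $\delta_j$. Let $\mathbf 1=(1,\dots,1)\in\mathbb Z^{1\times n}$, so $\mathbf 1a_j$ is the sum of the entries of $a_j$. It is known that for nontrivial $\mathcal U_B$ one has $1<p_*<2$, and $P_{\mathcal U_B}$ is bounded on $L^p(\mathcal U_B)$ if and only if $p_*<p<q_*$, with $q_*$ the Hölder conjugate of $p_*$. The Bergman projection $P_\Omega$ of a domain $\Omega$ is the orthogonal projection from $L^2(\Omega)$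 onto its subspace of holomorphic functions. A linear operator $T$ is of restricted weak type $(p,p)$ if there is $C>0$ such that $|\{z:|T(1_E)(z)|>y\}|\le\frac{C^p}{y^p}|E|$ for every measurable set $E$ of finite measure and every $y>0$ (here $|\cdot|$ of a set is Lebesgue measure and $1_E$ is the indicator function). *)

theory Defs
  imports "HOL-Complex_Analysis.Complex_Analysis" "Jordan_Normal_Form.Determinant"
begin

text \<open>
  The dimension \<open>n\<close> is existentially quantified in the theorem, so it cannot be a type:
  a point of \<open>\<complex>\<^sup>n\<close> is a function in \<open>{..<n} \<rightarrow>\<^sub>E UNIV\<close> (value \<open>undefined\<close>
  outside \<open>{..<n}\<close>), and all indices run over \<open>0, ..., n - 1\<close>.
\<close>

definition Cn_top :: "nat \<Rightarrow> (nat \<Rightarrow> complex) topology" where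
  "Cn_top n = product_topology (\<lambda>_. euclidean) {..<n}"

definition Cn_lebesgue :: "nat \<Rightarrow> (nat \<Rightarrow> complex) measure" where
  "Cn_lebesgue n = completion (PiM {..<n} (\<lambda>_. lborel))"

definition Cn_lebesgue_on :: "nat \<Rightarrow> (nat \<Rightarrow> complex) set \<Rightarrow> (nat \<Rightarrow> complex) measure" where
  "Cn_lebesgue_on n \<Omega> = restrict_space (Cn_lebesgue n) \<Omega>"

definition domain_Cn :: "nat \<Rightarrow> (nat \<Rightarrow> complex) set \<Rightarrow> bool" where
  "domain_Cn n \<Omega> \<longleftrightarrow> openin (Cn_top n) \<Omega> \<and> connectedin (Cn_top n) \<Omega> \<and> \<Omega> \<noteq> {}"

(* The library's "bounded" on function types refers to a bounded metric, so it is not usable here. *)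
definition bounded_Cn :: "nat \<Rightarrow> (nat \<Rightarrow> complex) set \<Rightarrow> bool" where
  "bounded_Cn n \<Omega> \<longleftrightarrow> (\<exists>R. \<forall>z\<in>\<Omega>. \<forall>k<n. cmod (z k) \<le> R)"

definition unit_polydisc :: "nat \<Rightarrow> (nat \<Rightarrow> complex) set" where
  "unit_polydisc n = {z \<in> {..<n} \<rightarrow>\<^sub>E UNIV. \<forall>k<n. cmod (z k) < 1}"

text \<open>Holomorphy in several variables: continuous, and holomorphic in each variable separately.\<close>

definition holomorphic_Cn ::
    "nat \<Rightarrow> (nat \<Rightarrow> complex) set \<Rightarrow> ((nat \<Rightarrow> complex) \<Rightarrow> complex) \<Rightarrow> bool" where
  "holomorphic_Cn n \<Omega> f \<longleftrightarrow>
     continuous_map (subtopology (Cn_top n) \<Omega>) euclidean f \<and>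
     (\<forall>z\<in>\<Omega>. \<forall>k<n. (\<lambda>w. f (z(k := w))) holomorphic_on {w. z(k := w) \<in> \<Omega>})"

definition L2_space :: "'a measure \<Rightarrow> ('a \<Rightarrow> complex) set" where
  "L2_space M = {f \<in> borel_measurable M. integrable M (\<lambda>x. (cmod (f x))\<^sup>2)}"

definition L2_inner :: "'a measure \<Rightarrow> ('a \<Rightarrow> complex) \<Rightarrow> ('a \<Rightarrow> complex) \<Rightarrow> complex" where
  "L2_inner M f g = (LINT x|M. f x * cnj (g x))"

definition bergman_space ::
    "nat \<Rightarrow> (nat \<Rightarrow> complex) set \<Rightarrow> ((nat \<Rightarrow> complex) \<Rightarrow> complex) set" where
  "bergman_space n \<Omega> = {g \<in> L2_space (Cn_lebesgue_on n \<Omega>). holomorphic_Cn n \<Omega> g}"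

text \<open>
  For \<open>f\<close> in \<open>L\<^sup>2(\<Omega>)\<close> the function chosen is unique on \<open>\<Omega>\<close>, because two
  continuous functions on an open set that agree almost everywhere agree; its values outside
  \<open>\<Omega>\<close> carry no meaning.
\<close>

definition bergman_projection ::
    "nat \<Rightarrow> (nat \<Rightarrow> complex) set \<Rightarrow> ((nat \<Rightarrow> complex) \<Rightarrow> complex) \<Rightarrow> (nat \<Rightarrow> complex) \<Rightarrow> complex" where
  "bergman_projection n \<Omega> f =
     (SOME g. g \<in> bergman_space n \<Omega> \<and>
        (\<forall>h\<in>bergman_space n \<Omega>. L2_inner (Cn_lebesgue_on n \<Omega>) (\<lambda>z. f z - g z) h = 0))"

definition restricted_weak_type ::
    "'a measure \<Rightarrow> real \<Rightarrow> (('a \<Rightarrow> complex) \<Rightarrow> 'a \<Rightarrow> complex) \<Rightarrow> bool" where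
  "restricted_weak_type M p T \<longleftrightarrow>
     (\<exists>C>0. \<forall>E\<in>sets M. emeasure M E < \<infinity> \<longrightarrow>
        (\<forall>y>0. emeasure M {z \<in> space M. cmod (T (indicator E) z) > y}
                 \<le> ennreal (C powr p / y powr p) * emeasure M E))"

text \<open>
  The condition on negative entries says that all powers are defined; it is needed because
  \<open>0 powi k = 0\<close> for negative \<open>k\<close>.
\<close>

definition U_dom :: "nat \<Rightarrow> int mat \<Rightarrow> (nat \<Rightarrow> complex) set" where
  "U_dom n B = {z \<in> {..<n} \<rightarrow>\<^sub>E UNIV. \<forall>j<n.
      (\<forall>k<n. B $$ (j, k) < 0 \<longrightarrow> z k \<noteq> 0) \<and>
      (\<Prod>k<n. cmod (z k) powi (B $$ (j, k))) < 1}"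

definition monomial_polyhedron :: "nat \<Rightarrow> int mat \<Rightarrow> bool" where
  "monomial_polyhedron n B \<longleftrightarrow>
     n \<ge> 2 \<and> B \<in> carrier_mat n n \<and> domain_Cn n (U_dom n B) \<and> bounded_Cn n (U_dom n B)"

definition nontrivial_monomial_polyhedron :: "nat \<Rightarrow> int mat \<Rightarrow> bool" where
  "nontrivial_monomial_polyhedron n B \<longleftrightarrow>
     monomial_polyhedron n B \<and> U_dom n B \<noteq> unit_polydisc n"

definition primitive_col :: "int mat \<Rightarrow> nat \<Rightarrow> int vec" where
  "primitive_col B j =
     (let \<delta> = col (adj_mat B) j in map_vec (\<lambda>x. x div Gcd (set\<^sub>v \<delta>)) \<delta>)"

definition p_star :: "nat \<Rightarrow> int mat \<Rightarrow> real" where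
  "p_star n B =
     Max ((\<lambda>j. let s = real_of_int (\<Sum>i<n. vec_index (primitive_col B j) i) in 2 * s / (s + 1)) ` {..<n})"

end

theory Submission
  imports Defs
begin

text \<open>
  The example is the three-dimensional domain
  \<open>U = {(x, y, w). 0 < \<bar>x\<bar> < 1, 0 < \<bar>y\<bar> < 1, \<bar>w\<bar> < \<bar>xy\<bar>}\<close>.  Its matrix has rows
  \<open>(1,0,0), (0,1,0), (-1,-1,1)\<close> and determinant 1, and its adjugate has columns \<open>(1,0,1)\<close>,
  \<open>(0,1,1)\<close>, \<open>(0,0,1)\<close> with entry sums 2, 2, 1.  So the maximum in \<open>p\<^sub>* = 4/3\<close> is attained by
  two columns, and this double attainment is what destroys the restricted weak type estimate.

  Write \<open>q = xy\<close>.  The fibre of \<open>U\<close> over \<open>(x, y)\<close> is a disc of area \<open>\<pi>\<bar>q\<bar>\<^sup>2\<close>.  The function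
  \<open>1/q\<close> is in the Bergman space, and a restricted weak type \<open>(4/3, 4/3)\<close> bound would force it into
  weak \<open>L\<^sup>4\<close>, that is, \<open>\<bar>{\<bar>q\<bar> < e}\<bar> = O(e\<^sup>4)\<close>.  But both \<open>x\<close> and \<open>y\<close> can make \<open>q\<close> small, and the
  measure of that set has order \<open>e\<^sup>4 log (1/e)\<close>; the lower bound is \<open>moment_ge\<close>, which finds
  \<open>N + 1\<close> disjoint dyadic pieces of equal size when \<open>e = 2\<^sup>-\<^sup>N\<close>.

  The quantitative version uses the test sets
  \<open>E = {\<bar>q\<bar> < e, 2\<bar>w\<bar>\<^sup>2 < \<bar>q\<bar>\<^sup>2 + \<bar>q\<bar> Re q}\<close>.  The fibre of \<open>E\<close> over \<open>(x, y)\<close> is a disc of area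
  \<open>(\<pi>/2)(\<bar>q\<bar>\<^sup>2 + \<bar>q\<bar> Re q)\<close>, so once \<open>w\<close> is integrated out the indicator of \<open>E\<close> has
  only the three angular modes \<open>1\<close>, \<open>q\<close> and \<open>1/q\<close>.  Hence its projection is an explicit Laurent
  polynomial \<open>c0 + c1/q + c2 q\<close>, with coefficients that are quotients of the moments
  \<open>J k e\<close>, the integral of \<open>\<bar>q\<bar>\<^sup>k\<close> over \<open>{\<bar>q\<bar> < e}\<close> in the punctured bidisc; this is
  \<open>bergman_identity\<close>.  Two facts of complex analysis enter: the mean value
  property in \<open>w\<close>, and the fact that the torus means of a function holomorphic on the punctured
  bidisc do not depend on the radii.

  For small \<open>e\<close> the coefficient \<open>c1\<close> dominates, so the projection exceeds \<open>c1/2\<close> everywhere on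
  \<open>U\<close>.  The restricted weak type estimate would then give \<open>\<bar>U\<bar> c1\<^sup>4\<^sup>/\<^sup>3 \<le> C \<bar>E\<bar>\<close>.  Here \<open>\<bar>E\<bar>\<close> is at
  most \<open>\<pi> J 2 e\<close> and \<open>c1\<close> is at least a constant times \<open>J 2 e / e\<close>, so \<open>J 2 e = O(e\<^sup>4)\<close>, which
  contradicts \<open>moment_ge\<close>; this is \<open>weak_type_bound_violated\<close>.
\<close>

section \<open>Rotation invariance of Lebesgue measure on the complex plane\<close>

lemma lborel_complex_eq:
  "(lborel :: complex measure) = distr (lborel \<Otimes>\<^sub>M lborel) borel (\<lambda>(x, y). Complex x y)"
proof (rule lborel_eqI)
  have m [measurable]: "(\<lambda>(x, y). Complex x y) \<in> borel_measurable (lborel \<Otimes>\<^sub>M lborel)"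
    unfolding lborel_prod case_prod_unfold Complex_eq
    by (simp, intro borel_measurable_continuous_onI continuous_intros)
  fix l u :: complex
  assume le: "\<And>b. b \<in> Basis \<Longrightarrow> l \<bullet> b \<le> u \<bullet> b"
  have "Re l \<le> Re u" "Im l \<le> Im u"
    using le[of 1] le[of \<i>] by (auto simp: Basis_complex_def inner_complex_def)
  moreover have "(\<lambda>(x, y). Complex x y) -` box l u \<inter> space (lborel \<Otimes>\<^sub>M lborel)
      = {Re l<..<Re u} \<times> {Im l<..<Im u}"
    by (auto simp: box_def Basis_complex_def inner_complex_def space_pair_measure)
  ultimately show "emeasure (distr (lborel \<Otimes>\<^sub>M lborel) borel (\<lambda>(x, y). Complex x y)) (box l u)
      = ennreal (\<Prod>b\<in>Basis. (u - l) \<bullet> b)"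
    by (simp add: emeasure_distr lborel.emeasure_pair_measure_Times Basis_complex_def
        inner_complex_def ennreal_mult)
qed simp

text \<open>
  Fubini reduces a shear to a translation of each line.
\<close>

lemma distr_shear:
  fixes k :: real
  shows "distr (lborel \<Otimes>\<^sub>M lborel) (lborel \<Otimes>\<^sub>M lborel) (\<lambda>(x, y). (x + k * y, y))
    = (lborel \<Otimes>\<^sub>M lborel)" (is "distr ?M ?M ?S = _")
    and "distr (lborel \<Otimes>\<^sub>M lborel) (lborel \<Otimes>\<^sub>M lborel) (\<lambda>(x, y). (x, y + k * x))
    = (lborel \<Otimes>\<^sub>M lborel)" (is "distr ?M ?M ?S' = _")
proof -
  have tr: "(\<integral>\<^sup>+x. f (x + c) \<partial>lborel) = (\<integral>\<^sup>+x. f x \<partial>lborel)"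
    if "f \<in> borel_measurable borel" for f :: "real \<Rightarrow> ennreal" and c
  proof -
    have "(\<integral>\<^sup>+x. f x \<partial>lborel) = (\<integral>\<^sup>+x. f x \<partial>distr lborel borel ((+) c))"
      by (simp add: lborel_distr_plus)
    also have "\<dots> = (\<integral>\<^sup>+x. f (x + c) \<partial>lborel)"
      using that by (subst nn_integral_distr) (auto simp: add.commute)
    finally show ?thesis by simp
  qed
  have S: "?S \<in> ?M \<rightarrow>\<^sub>M ?M" and S': "?S' \<in> ?M \<rightarrow>\<^sub>M ?M"
    by (auto simp: case_prod_unfold)
  show "distr ?M ?M ?S = ?M"
  proof (rule measure_eqI)
    fix A assume "A \<in> sets (distr ?M ?M ?S)"
    then have A: "A \<in> sets ?M" by (simp only: sets_distr)
    define f :: "real \<times> real \<Rightarrow> ennreal" where "f = indicator A"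
    have f: "f \<in> borel_measurable ?M"
      unfolding f_def using A by (rule borel_measurable_indicator)
    have "emeasure (distr ?M ?M ?S) A = (\<integral>\<^sup>+z. f z \<partial>distr ?M ?M ?S)"
      unfolding f_def by (rule nn_integral_indicator[symmetric]) (simp only: sets_distr A)
    also have "\<dots> = (\<integral>\<^sup>+z. f (?S z) \<partial>?M)"
      by (rule nn_integral_distr[OF S f[folded measurable_distr_eq1[of ?M ?M ?S]]])
    also have "\<dots> = (\<integral>\<^sup>+y. \<integral>\<^sup>+x. f (x + k * y, y) \<partial>lborel \<partial>lborel)"
      by (subst lborel_pair.nn_integral_snd[OF measurable_compose[OF S f], symmetric]) simp
    also have "\<dots> = (\<integral>\<^sup>+y. \<integral>\<^sup>+x. f (x, y) \<partial>lborel \<partial>lborel)"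
      by (intro nn_integral_cong tr measurable_compose[OF _ f]) simp
    also have "\<dots> = emeasure ?M A"
      by (subst lborel_pair.nn_integral_snd[OF f]) (simp only: f_def nn_integral_indicator[OF A])
    finally show "emeasure (distr ?M ?M ?S) A = emeasure ?M A" .
  qed simp
  show "distr ?M ?M ?S' = ?M"
  proof (rule measure_eqI)
    fix A assume "A \<in> sets (distr ?M ?M ?S')"
    then have A: "A \<in> sets ?M" by (simp only: sets_distr)
    define f :: "real \<times> real \<Rightarrow> ennreal" where "f = indicator A"
    have f: "f \<in> borel_measurable ?M"
      unfolding f_def using A by (rule borel_measurable_indicator)
    have "emeasure (distr ?M ?M ?S') A = (\<integral>\<^sup>+z. f z \<partial>distr ?M ?M ?S')"
      unfolding f_def by (rule nn_integral_indicator[symmetric]) (simp only: sets_distr A)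
    also have "\<dots> = (\<integral>\<^sup>+z. f (?S' z) \<partial>?M)"
      by (rule nn_integral_distr[OF S' f[folded measurable_distr_eq1[of ?M ?M ?S']]])
    also have "\<dots> = (\<integral>\<^sup>+x. \<integral>\<^sup>+y. f (x, y + k * x) \<partial>lborel \<partial>lborel)"
      by (subst lborel.nn_integral_fst[OF measurable_compose[OF S' f], symmetric]) simp
    also have "\<dots> = (\<integral>\<^sup>+x. \<integral>\<^sup>+y. f (x, y) \<partial>lborel \<partial>lborel)"
      by (intro nn_integral_cong tr measurable_compose[OF _ f]) simp
    also have "\<dots> = emeasure ?M A"
      by (subst lborel.nn_integral_fst[OF f]) (simp only: f_def nn_integral_indicator[OF A])
    finally show "emeasure (distr ?M ?M ?S') A = emeasure ?M A" .
  qed simp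
qed

text \<open>
  A rotation with \<open>Im c \<noteq> 0\<close> is a product of three shears, and shears preserve area.  The remaining
  rotations are \<open>1\<close> and \<open>-1\<close>, the second being the square of the rotation by \<open>\<i>\<close>.
\<close>

lemma lborel_complex_rotation:
  fixes c :: complex
  assumes c: "cmod c = 1"
  shows "distr lborel borel ((*) c) = lborel"
proof -
  let ?M = "lborel \<Otimes>\<^sub>M lborel :: (real \<times> real) measure"
  let ?C = "\<lambda>(x, y). Complex x y"
  have C [measurable]: "?C \<in> ?M \<rightarrow>\<^sub>M borel"
    unfolding lborel_prod case_prod_unfold Complex_eq
    by (simp, intro borel_measurable_continuous_onI continuous_intros)
  have gen: "distr lborel borel ((*) c) = lborel"
    if c: "cmod c = 1" and im: "Im c \<noteq> 0" for c
  proof -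
    \<comment> \<open>The shear factor is minus the tangent of half the angle.\<close>
    define k where "k = (Re c - 1) / Im c"
    let ?S = "\<lambda>(x, y). (x + k * y, y)" and ?T = "\<lambda>(x, y). (x, y + Im c * x)"
    have S: "?S \<in> ?M \<rightarrow>\<^sub>M ?M" and T: "?T \<in> ?M \<rightarrow>\<^sub>M ?M"
      by (auto simp: case_prod_unfold)
    have c1: "Re c * Re c + Im c * Im c = 1"
      using c by (simp add: cmod_def power2_eq_square)
    have k1: "1 + k * Im c = Re c"
      using im by (simp add: k_def)
    have "(k * Re c + k) * Im c = (- Im c) * Im c"
    proof -
      have "(k * Re c + k) * Im c = (k * Im c) * (Re c + 1)"
        by (simp add: algebra_simps)
      also have "k * Im c = Re c - 1"
        using k1 by simp
      finally show ?thesis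
        using c1 by (simp add: algebra_simps)
    qed
    then have k2: "k * Re c + k = - Im c"
      using im by (metis mult_cancel_right)
    have rot: "c * ?C z = ?C (?S (?T (?S z)))" for z
    proof (cases z)
      case (Pair x y)
      have "x + k * y + k * (y + Im c * (x + k * y)) = (1 + k * Im c) * x + (k * (1 + k * Im c) + k) * y"
        by (simp add: algebra_simps)
      also have "\<dots> = Re c * x - Im c * y"
        unfolding k1 k2 by simp
      moreover have "y + Im c * (x + k * y) = Im c * x + (1 + k * Im c) * y"
        by (simp add: algebra_simps)
      ultimately show ?thesis
        using k1 by (simp add: Pair complex_eq_iff)
    qed
    have "distr lborel borel ((*) c) = distr ?M borel (\<lambda>z. c * ?C z)"
      by (subst lborel_complex_eq, subst distr_distr) (auto simp: comp_def)
    also have "\<dots> = distr ?M borel (\<lambda>z. ?C (?S (?T (?S z))))"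
      unfolding rot ..
    also have "\<dots> = distr ?M borel (\<lambda>z. ?C (?S (?T z)))"
      using distr_distr[OF measurable_compose[OF T measurable_compose[OF S C]] S]
      unfolding distr_shear comp_def by (rule sym)
    also have "\<dots> = distr ?M borel (\<lambda>z. ?C (?S z))"
      using distr_distr[OF measurable_compose[OF S C] T]
      unfolding distr_shear comp_def by (rule sym)
    also have "\<dots> = distr ?M borel ?C"
      using distr_distr[OF C S]
      unfolding distr_shear comp_def by (rule sym)
    also have "\<dots> = lborel"
      by (rule lborel_complex_eq[symmetric])
    finally show ?thesis .
  qed
  show ?thesis
  proof (cases "Im c = 0")
    case False
    with gen[OF c] show ?thesis by simp
  next
    case True
    then have "c = 1 \<or> c = \<i> * \<i>"
      using c by (auto simp: complex_eq_iff cmod_def)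
    moreover have "distr lborel borel ((*) (\<i> * \<i>)) = distr (distr lborel borel ((*) \<i>)) borel ((*) \<i>)"
    proof -
      have "(*) (\<i> * \<i>) = (*) \<i> \<circ> (*) \<i>"
        by (simp only: fun_eq_iff comp_def mult.assoc simp_thms)
      moreover have m: "(*) \<i> \<in> borel \<rightarrow>\<^sub>M borel" "(*) \<i> \<in> lborel \<rightarrow>\<^sub>M borel"
        by auto
      ultimately show ?thesis
        using distr_distr[OF m] by (simp only:)
    qed
    moreover have "distr lborel borel ((*) \<i>) = lborel"
      by (rule gen) auto
    moreover have "distr lborel borel ((*) (1::complex)) = lborel"
    proof -
      have "(*) (1::complex) = (+) 0" by (simp add: fun_eq_iff)
      then show ?thesis using lborel_distr_plus[of "0::complex"] by (simp only:)
    qed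
    ultimately show ?thesis by metis
  qed
qed

section \<open>Means over circles\<close>

text \<open>
  Averaging over a probability space of measure-preserving maps does not change an integral.  With
  the maps taken to be rotations this replaces polar coordinates in everything that follows.
\<close>

lemma integral_measure_preserving_average:
  fixes \<Phi> :: "'a \<Rightarrow> complex" and S :: "'p \<times> 'a \<Rightarrow> 'a"
  assumes P: "emeasure P (space P) = 1" and M: "sigma_finite_measure M"
    and S: "S \<in> P \<Otimes>\<^sub>M M \<rightarrow>\<^sub>M M"
    and inv: "\<And>p. p \<in> space P \<Longrightarrow> distr M M (\<lambda>x. S (p, x)) = M"
    and \<Phi>: "integrable M \<Phi>"
  shows "integral\<^sup>L M \<Phi> = (\<integral>x. (\<integral>p. \<Phi> (S (p, x)) \<partial>P) \<partial>M)"
proof -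
  interpret P: finite_measure P
    by rule (simp add: P)
  interpret M: sigma_finite_measure M by fact
  interpret PM: pair_sigma_finite P M ..
  have sec: "(\<lambda>x. S (p, x)) \<in> M \<rightarrow>\<^sub>M M" if "p \<in> space P" for p
    using that by (intro measurable_compose[OF _ S]) simp
  have int: "integrable M (\<lambda>x. \<Phi> (S (p, x)))"
    and eq: "(\<integral>x. \<Phi> (S (p, x)) \<partial>M) = integral\<^sup>L M \<Phi>"
    and nrm: "(\<integral>x. norm (\<Phi> (S (p, x))) \<partial>M) = (\<integral>x. norm (\<Phi> x) \<partial>M)" if p: "p \<in> space P" for p
  proof -
    have \<Phi>': "integrable (distr M M (\<lambda>x. S (p, x))) \<Phi>"
      unfolding inv[OF p] by (rule \<Phi>)
    show "integrable M (\<lambda>x. \<Phi> (S (p, x)))"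
      by (rule integrable_distr[OF sec[OF p] \<Phi>'])
    show "(\<integral>x. \<Phi> (S (p, x)) \<partial>M) = integral\<^sup>L M \<Phi>"
      using integral_distr[OF sec[OF p], of \<Phi>] \<Phi> unfolding inv[OF p] by auto
    show "(\<integral>x. norm (\<Phi> (S (p, x))) \<partial>M) = (\<integral>x. norm (\<Phi> x) \<partial>M)"
      using integral_distr[OF sec[OF p], of "\<lambda>x. norm (\<Phi> x)"] \<Phi> unfolding inv[OF p] by auto
  qed
  have "integrable (P \<Otimes>\<^sub>M M) (\<lambda>z. \<Phi> (S z))"
  proof (rule PM.Fubini_integrable)
    show "(\<lambda>z. \<Phi> (S z)) \<in> borel_measurable (P \<Otimes>\<^sub>M M)"
      using \<Phi> by (intro measurable_compose[OF S]) auto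
    have "integrable P (\<lambda>p. \<integral>x. norm (\<Phi> x) \<partial>M)"
      by simp
    then show "integrable P (\<lambda>p. \<integral>x. norm (\<Phi> (S (p, x))) \<partial>M)"
      by (subst Bochner_Integration.integrable_cong[OF refl nrm])
    show "AE p in P. integrable M (\<lambda>x. \<Phi> (S (p, x)))"
      using int by simp
  qed
  then have "(\<integral>x. (\<integral>p. \<Phi> (S (p, x)) \<partial>P) \<partial>M) = (\<integral>p. (\<integral>x. \<Phi> (S (p, x)) \<partial>M) \<partial>P)"
    by (intro PM.Fubini_integral) (simp add: case_prod_unfold)
  also have "\<dots> = (\<integral>p. integral\<^sup>L M \<Phi> \<partial>P)"
    by (intro Bochner_Integration.integral_cong refl eq)
  also have "\<dots> = integral\<^sup>L M \<Phi>"
    using P by (simp add: measure_def)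
  finally show ?thesis by simp
qed

definition turn :: "real \<Rightarrow> complex" where "turn t = cis (2 * pi * t)"

text \<open>
  Angles are measured in full turns, which makes this a probability measure.
\<close>

definition turns :: "real measure" where "turns = restrict_space lborel {0..1}"

lemma turn_simps [simp]: "cmod (turn t) = 1" "turn t \<noteq> 0"
  by (auto simp: turn_def)

lemma continuous_turn [continuous_intros]:
  "continuous_on S f \<Longrightarrow> continuous_on S (\<lambda>x. turn (f x))"
  unfolding turn_def by (intro continuous_intros)

lemma turns_prob: "emeasure turns (space turns) = 1"
  by (simp add: turns_def emeasure_restrict_space space_restrict_space)

lemma measurable_turns: "f \<in> borel_measurable borel \<Longrightarrow> f \<in> borel_measurable turns"
  unfolding turns_def by (intro measurable_restrict_space1) simp

lemma integral_turns:
  fixes f :: "real \<Rightarrow> complex"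
  assumes "continuous_on UNIV f"
  shows "(\<integral>t. f t \<partial>turns) = integral {0..1} f"
proof -
  have "set_integrable lborel {0..1} f"
    by (rule borel_integrable_atLeastAtMost') (rule continuous_on_subset[OF assms], simp)
  from set_borel_integral_eq_integral(2)[OF this] show ?thesis
    by (simp add: turns_def integral_restrict_space set_lebesgue_integral_def)
qed

text \<open>
  The mean over the circle through \<open>x\<close> is the residue of \<open>f z / z\<close>, so it depends neither
  on the radius nor on the starting point \<open>x\<close>.
\<close>

lemma circle_mean_punctured:
  fixes f :: "complex \<Rightarrow> complex"
  assumes f: "f holomorphic_on ball 0 R - {0}" and x: "x \<in> ball 0 R - {0}"
  shows "(\<integral>t. f (turn t * x) \<partial>turns) = residue (\<lambda>z. f z / z) 0"
proof -
  define r where "r = cmod x"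
  have r: "0 < r" "r < R" using x by (auto simp: r_def)
  \<comment> \<open>The circle is traversed from x, that is, from the parameter a of the standard circle path.\<close>
  define a where "a = frac (Arg x / (2 * pi))"
  have a: "a \<in> {0..1}"
    using frac_lt_1[of "Arg x / (2 * pi)"] by (auto simp: a_def intro: less_imp_le)
  have "x = of_real r * cis (Arg x)"
    using rcis_cmod_Arg[of x] by (simp add: r_def rcis_def)
  also have "cis (Arg x) = cis (2 * pi * a)"
  proof -
    have "2 * pi * a = Arg x - 2 * pi * of_int \<lfloor>Arg x / (2 * pi)\<rfloor>"
      by (simp add: a_def frac_def algebra_simps)
    then show ?thesis
      by (simp add: cis_divide[symmetric] cis_multiple_2pi)
  qed
  finally have xa: "x = of_real r * cis (2 * pi * a)" .
  let ?g = "\<lambda>z. f z / z"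
  have "(?g has_contour_integral 2 * pi * \<i> * residue ?g 0) (circlepath 0 r)"
    using r f by (intro base_residue[of "ball 0 R"]) (auto intro!: holomorphic_intros)
  then have "(?g has_contour_integral 2 * pi * \<i> * residue ?g 0) (shiftpath a (circlepath 0 r))"
    using a by (intro has_contour_integral_shiftpath) auto
  then have hi: "((\<lambda>t. ?g (shiftpath a (circlepath 0 r) t)
      * vector_derivative (shiftpath a (circlepath 0 r)) (at t within {0..1}))
      has_integral (2 * pi * \<i> * residue ?g 0)) {0..1}"
    unfolding has_contour_integral_def .
  have sp: "shiftpath a (circlepath 0 r) t = turn t * x" if "t \<in> {0..1}" for t
  proof -
    have 1: "circlepath 0 r s = of_real r * cis (2 * pi * s)" for s
      by (simp add: circlepath cis_conv_exp mult_ac)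
    have 2: "cis (2 * pi * (a + t - 1)) = cis (2 * pi * (a + t))"
      using cis_divide[of "2 * pi * (a + t)" "2 * pi", symmetric]
      by (simp add: right_diff_distrib' mult.commute[of pi 2])
    show ?thesis
      unfolding shiftpath_def 1 using 2
      by (simp add: xa turn_def cis_mult algebra_simps)
  qed
  have eq: "?g (shiftpath a (circlepath 0 r) t) * vector_derivative (shiftpath a (circlepath 0 r)) (at t within {0..1})
      = 2 * pi * \<i> * f (turn t * x)" if t: "t \<in> {0..1}" for t
  proof -
    have "((\<lambda>t. turn t * x) has_vector_derivative (2 * pi * \<i> * turn t * x)) (at t within {0..1})"
    proof -
      have "((\<lambda>z. exp (2 * pi * \<i> * z) * x) has_field_derivative (2 * pi * \<i> * turn t * x)) (at (of_real t))"
        by (auto intro!: derivative_eq_intros simp: turn_def cis_conv_exp mult_ac)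
      from has_vector_derivative_real_field[OF this] show ?thesis
        by (simp add: turn_def cis_conv_exp mult_ac)
    qed
    then have "(shiftpath a (circlepath 0 r) has_vector_derivative (2 * pi * \<i> * turn t * x)) (at t within {0..1})"
      by (rule has_vector_derivative_transform[OF t, rotated]) (simp add: sp)
    then have "vector_derivative (shiftpath a (circlepath 0 r)) (at t within {0..1}) = 2 * pi * \<i> * turn t * x"
      using t by (intro vector_derivative_within_closed_interval) auto
    then show ?thesis using x sp[OF t] by simp
  qed
  have "((\<lambda>t. 2 * pi * \<i> * f (turn t * x)) has_integral (2 * pi * \<i> * residue ?g 0)) {0..1}"
    by (rule has_integral_eq[OF eq hi])
  from has_integral_mult_right[OF this, of "1 / (2 * pi * \<i>)"]
  have "((\<lambda>t. f (turn t * x)) has_integral residue ?g 0) {0..1}"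
    by simp
  moreover have "continuous_on UNIV (\<lambda>t. f (turn t * x))"
    using x by (intro continuous_on_compose2[OF holomorphic_on_imp_continuous_on[OF f]] continuous_intros)
      (auto simp: norm_mult)
  ultimately show ?thesis
    by (simp add: integral_turns integral_unique)
qed

lemma circle_mean:
  fixes f :: "complex \<Rightarrow> complex"
  assumes f: "f holomorphic_on ball 0 R" and x: "x \<in> ball 0 R"
  shows "(\<integral>t. f (turn t * x) \<partial>turns) = f 0"
proof (cases "x = 0")
  case True
  then show ?thesis using turns_prob by (simp add: measure_def)
next
  case False
  then have R: "R > 0" using x by (auto intro: le_less_trans[OF norm_ge_zero])
  have "(\<integral>t. f (turn t * x) \<partial>turns) = residue (\<lambda>z. f z / z) 0"
    using f x False by (intro circle_mean_punctured[of _ R]) (auto intro: holomorphic_on_subset)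
  also have "\<dots> = f 0"
    using residue_simple[of "ball 0 R" 0 f] f R by simp
  finally show ?thesis .
qed

section \<open>Means over tori and discs\<close>

definition punctured_disc :: "complex set" where "punctured_disc = ball 0 1 - {0}"

lemma in_punctured_disc: "x \<in> punctured_disc \<longleftrightarrow> 0 < cmod x \<and> cmod x < 1"
  by (auto simp: punctured_disc_def)

lemma turn_mult_punctured_disc [simp]: "turn t * x \<in> punctured_disc \<longleftrightarrow> x \<in> punctured_disc"
  by (simp add: in_punctured_disc norm_mult)

lemma open_punctured_disc: "open punctured_disc"
  unfolding punctured_disc_def by (intro open_Diff) auto

lemma finite_measure_turns: "finite_measure turns"
  by rule (simp add: turns_prob)

lemma measurable_turns_pair: 
  assumes "continuous_on UNIV G"
  shows "G \<in> borel_measurable (turns \<Otimes>\<^sub>M turns)"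
proof -
  have "(\<lambda>p. (fst p, snd p)) \<in> turns \<Otimes>\<^sub>M turns \<rightarrow>\<^sub>M borel \<Otimes>\<^sub>M borel"
    by (intro measurable_Pair measurable_compose[OF measurable_fst] measurable_compose[OF measurable_snd]
        measurable_turns) auto
  from measurable_compose[OF this[unfolded borel_prod] borel_measurable_continuous_onI[OF assms]]
  show ?thesis by simp
qed

text \<open>
  By Fubini the torus mean is an iterated circle mean, in either order.  The inner mean is a residue,
  hence constant in the first variable for one order and in the second variable for the other.
\<close>

lemma torus_mean_const:
  fixes F :: "complex \<times> complex \<Rightarrow> complex"
  assumes cont: "continuous_on (punctured_disc \<times> punctured_disc) F"
    and h1: "\<And>y. y \<in> punctured_disc \<Longrightarrow> (\<lambda>x. F (x, y)) holomorphic_on punctured_disc"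
    and h2: "\<And>x. x \<in> punctured_disc \<Longrightarrow> (\<lambda>y. F (x, y)) holomorphic_on punctured_disc"
  obtains A where "\<And>x y. x \<in> punctured_disc \<Longrightarrow> y \<in> punctured_disc \<Longrightarrow>
    (\<integral>p. F (turn (fst p) * x, turn (snd p) * y) \<partial>(turns \<Otimes>\<^sub>M turns)) = A"
proof -
  interpret T: finite_measure turns by (rule finite_measure_turns)
  interpret TT: pair_sigma_finite turns turns ..
  interpret TF: finite_measure "turns \<Otimes>\<^sub>M turns"
    by rule (simp add: space_pair_measure T.emeasure_pair_measure_Times turns_prob)
  define I where "I = (\<lambda>x y. \<integral>p. F (turn (fst p) * x, turn (snd p) * y) \<partial>(turns \<Otimes>\<^sub>M turns))"
  have int: "integrable (turns \<Otimes>\<^sub>M turns) (case_prod (\<lambda>t s. F (turn t * x, turn s * y)))"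
    if xy: "x \<in> punctured_disc" "y \<in> punctured_disc" for x y
  proof -
    let ?G = "case_prod (\<lambda>t s. F (turn t * x, turn s * y))"
    have c: "continuous_on UNIV ?G"
      unfolding case_prod_unfold
      by (intro continuous_on_compose2[OF cont] continuous_intros) (auto simp: xy)
    have "compact (?G ` ({0..1} \<times> {0..1}))"
      by (intro compact_continuous_image continuous_on_subset[OF c] compact_Times) auto
    then obtain b where b: "\<forall>u \<in> ?G ` ({0..1} \<times> {0..1}). norm u \<le> b"
      by (meson compact_imp_bounded bounded_iff)
    show ?thesis
    proof (rule TF.integrable_const_bound)
      show "AE p in turns \<Otimes>\<^sub>M turns. norm (?G p) \<le> b"
        by (rule AE_I2, rule b[rule_format], rule imageI) (simp add: space_pair_measure turns_def space_restrict_space)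
      show "?G \<in> borel_measurable (turns \<Otimes>\<^sub>M turns)"
        by (rule measurable_turns_pair[OF c])
    qed
  qed
  have hol: "f holomorphic_on punctured_disc \<Longrightarrow> x \<in> punctured_disc \<Longrightarrow>
      (\<integral>t. f (turn t * x) \<partial>turns) = residue (\<lambda>z. f z / z) 0" for f x
    unfolding punctured_disc_def by (rule circle_mean_punctured)
  have 1: "I x y = I x' y" if "x \<in> punctured_disc" "x' \<in> punctured_disc" "y \<in> punctured_disc" for x x' y
  proof -
    have "I x y = (\<integral>s. residue (\<lambda>z. F (z, turn s * y) / z) 0 \<partial>turns)" if "x \<in> punctured_disc" for x
      unfolding I_def
      using TT.integral_snd[OF int[OF that \<open>y \<in> punctured_disc\<close>], symmetric]
      by (simp add: hol[OF h1 that] that \<open>y \<in> punctured_disc\<close> case_prod_unfold)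
    then show ?thesis using that by simp
  qed
  have 2: "I x y = I x y'" if "x \<in> punctured_disc" "y \<in> punctured_disc" "y' \<in> punctured_disc" for x y y'
  proof -
    have "I x y = (\<integral>t. residue (\<lambda>z. F (turn t * x, z) / z) 0 \<partial>turns)" if "y \<in> punctured_disc" for y
      unfolding I_def
      using TT.integral_fst[OF int[OF \<open>x \<in> punctured_disc\<close> that], symmetric]
      by (simp add: hol[OF h2 that] that \<open>x \<in> punctured_disc\<close> case_prod_unfold)
    then show ?thesis using that by simp
  qed
  have "1/2 \<in> punctured_disc" by (simp add: in_punctured_disc)
  then have "I x y = I (1/2) (1/2)" if "x \<in> punctured_disc" "y \<in> punctured_disc" for x y
    using 1 2 that by metis
  then show thesis
    using that unfolding I_def by blast
qed

lemma distr_lborel_rotation: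
  assumes "cmod c = 1"
  shows "distr lborel lborel ((*) c) = lborel"
  using lborel_complex_rotation[OF assms] by (simp cong: distr_cong)

text \<open>
  A weight that is invariant under the torus sees only the torus mean of the function it multiplies.
\<close>

lemma integral_torus_average:
  fixes \<rho> F :: "complex \<times> complex \<Rightarrow> complex"
  assumes rot: "\<And>c d x y. cmod c = 1 \<Longrightarrow> cmod d = 1 \<Longrightarrow> \<rho> (c * x, d * y) = \<rho> (x, y)"
    and supp: "\<And>x y. \<not> (x \<in> punctured_disc \<and> y \<in> punctured_disc) \<Longrightarrow> \<rho> (x, y) = 0"
    and mean: "\<And>x y. x \<in> punctured_disc \<Longrightarrow> y \<in> punctured_disc \<Longrightarrow>
      (\<integral>p. F (turn (fst p) * x, turn (snd p) * y) \<partial>(turns \<Otimes>\<^sub>M turns)) = A"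
    and int: "integrable lborel (\<lambda>v. \<rho> v * F v)"
  shows "(\<integral>v. \<rho> v * F v \<partial>lborel) = A * (\<integral>v. \<rho> v \<partial>lborel)"
proof -
  interpret T: finite_measure turns by (rule finite_measure_turns)
  let ?P = "turns \<Otimes>\<^sub>M turns"
  define S :: "(real \<times> real) \<times> complex \<times> complex \<Rightarrow> complex \<times> complex"
    where "S = (\<lambda>p. (turn (fst (fst p)) * fst (snd p), turn (snd (fst p)) * snd (snd p)))"
  have t [measurable]: "turn \<in> borel_measurable turns"
    by (intro measurable_turns borel_measurable_continuous_onI continuous_intros)
  have S: "S \<in> ?P \<Otimes>\<^sub>M lborel \<rightarrow>\<^sub>M lborel"
    unfolding S_def lborel_prod[symmetric] by measurable
  have inv: "distr lborel lborel (\<lambda>v. S (p, v)) = lborel" for p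
  proof -
    let ?a = "turn (fst p)" and ?b = "turn (snd p)"
    have "distr (lborel \<Otimes>\<^sub>M lborel) (lborel \<Otimes>\<^sub>M lborel) (\<lambda>(x, y). (?a * x, ?b * y))
      = distr lborel lborel ((*) ?a) \<Otimes>\<^sub>M distr lborel lborel ((*) ?b)"
      by (rule pair_measure_distr[symmetric]) (auto simp: distr_lborel_rotation lborel.sigma_finite_measure_axioms)
    then show ?thesis
      by (simp add: distr_lborel_rotation lborel_prod S_def case_prod_unfold)
  qed
  have "emeasure ?P (space ?P) = 1"
    by (simp add: space_pair_measure T.emeasure_pair_measure_Times turns_prob)
  then have "(\<integral>v. \<rho> v * F v \<partial>lborel) = (\<integral>v. (\<integral>p. \<rho> (S (p, v)) * F (S (p, v)) \<partial>?P) \<partial>lborel)"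
    by (rule integral_measure_preserving_average[OF _ lborel.sigma_finite_measure_axioms S inv int])
  also have "\<dots> = (\<integral>v. \<rho> v * A \<partial>lborel)"
  proof (rule Bochner_Integration.integral_cong[OF refl])
    fix v :: "complex \<times> complex"
    obtain x y where v: "v = (x, y)" by (cases v)
    have \<rho>: "\<rho> (S (p, v)) = \<rho> v" for p
      by (simp add: S_def v rot)
    show "(\<integral>p. \<rho> (S (p, v)) * F (S (p, v)) \<partial>?P) = \<rho> v * A"
    proof (cases "x \<in> punctured_disc \<and> y \<in> punctured_disc")
      case True
      then show ?thesis
        unfolding \<rho> using mean[of x y] by (simp add: S_def v)
    next
      case False
      then show ?thesis unfolding \<rho> using supp by (simp add: v)
    qed
  qed
  finally show ?thesis by simp
qed

lemma measure_disc: "r \<ge> 0 \<Longrightarrow> measure lborel (ball (0::complex) r) = pi * r\<^sup>2"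
  by (simp add: content_ball unit_ball_vol_2)

lemma disc_mean:
  fixes g :: "complex \<Rightarrow> complex"
  assumes hol: "g holomorphic_on ball 0 r" and int: "integrable lborel (\<lambda>w. indicator (ball 0 r) w * g w)"
    and r: "r \<ge> 0"
  shows "(\<integral>w. indicator (ball 0 r) w * g w \<partial>lborel) = of_real (pi * r\<^sup>2) * g 0"
proof -
  define S :: "real \<times> complex \<Rightarrow> complex" where "S = (\<lambda>p. turn (fst p) * snd p)"
  have t [measurable]: "turn \<in> borel_measurable turns"
    by (intro measurable_turns borel_measurable_continuous_onI continuous_intros)
  have S: "S \<in> turns \<Otimes>\<^sub>M lborel \<rightarrow>\<^sub>M lborel"
    unfolding S_def measurable_lborel1 by measurable
  have inv: "distr lborel lborel (\<lambda>v. S (p, v)) = lborel" for p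
    by (simp add: S_def distr_lborel_rotation)
  have "(\<integral>w. indicator (ball 0 r) w * g w \<partial>lborel)
    = (\<integral>w. (\<integral>p. indicator (ball 0 r) (S (p, w)) * g (S (p, w)) \<partial>turns) \<partial>lborel)"
    by (rule integral_measure_preserving_average[OF turns_prob lborel.sigma_finite_measure_axioms S inv int])
  also have "\<dots> = (\<integral>w. indicator (ball (0::complex) r) w * g 0 \<partial>lborel)"
  proof (rule Bochner_Integration.integral_cong[OF refl])
    fix w :: complex
    have *: "indicator (ball 0 r) (S (p, w)) = (indicator (ball 0 r) w :: complex)" for p
      by (simp add: S_def indicator_def norm_mult)
    show "(\<integral>p. indicator (ball 0 r) (S (p, w)) * g (S (p, w)) \<partial>turns) = indicator (ball 0 r) w * g 0"
      unfolding * using circle_mean[OF hol, of w]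
      by (cases "w \<in> ball 0 r") (simp_all add: S_def)
  qed
  also have "\<dots> = of_real (measure lborel (ball (0::complex) r)) * g 0"
  proof -
    have "(\<integral>w. indicator (ball (0::complex) r) w *\<^sub>R g 0 \<partial>lborel) = measure lborel (ball (0::complex) r) *\<^sub>R g 0"
      by (rule has_bochner_integral_integral_eq[OF has_bochner_integral_indicator])
        (auto intro: emeasure_bounded_finite[OF bounded_ball, simplified])
    also have "\<dots> = of_real (measure lborel (ball (0::complex) r)) * g 0"
      by (simp only: scaleR_conv_of_real)
    also have "(\<integral>w. indicator (ball (0::complex) r) w *\<^sub>R g 0 \<partial>lborel)
        = (\<integral>w. indicator (ball (0::complex) r) w * g 0 \<partial>lborel)"
      by (intro Bochner_Integration.integral_cong refl) (simp add: indicator_def)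
    finally show ?thesis .
  qed
  finally show ?thesis using r by (simp add: measure_disc)
qed

text \<open>
  If the fibres of \<open>S\<close> are discs centred at 0 and \<open>h\<close> is holomorphic along them, then integrating
  out the fibre variable replaces \<open>h\<close> by its value at the centre times the area of the disc.
  Measurability of the result is a hypothesis because the mean value property only holds on
  those fibres where \<open>h\<close> is integrable, that is, almost everywhere.
\<close>

lemma fiber_integral:
  fixes h :: "'a::euclidean_space \<times> complex \<Rightarrow> complex"
  assumes int: "integrable lborel (\<lambda>v. indicator S v * h v)"
    and S: "\<And>z w. (z, w) \<in> S \<longleftrightarrow> z \<in> D \<and> cmod w < r z"
    and hol: "\<And>z. z \<in> D \<Longrightarrow> (\<lambda>w. h (z, w)) holomorphic_on ball 0 (r z)"
    and r: "\<And>z. z \<in> D \<Longrightarrow> r z \<ge> 0"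
    and meas: "(\<lambda>z. indicator D z * (of_real (pi * (r z)\<^sup>2) * h (z, 0))) \<in> borel_measurable lborel"
  shows "integrable lborel (\<lambda>z. indicator D z * (of_real (pi * (r z)\<^sup>2) * h (z, 0)))"
    and "(\<integral>v. indicator S v * h v \<partial>lborel)
      = (\<integral>z. indicator D z * (of_real (pi * (r z)\<^sup>2) * h (z, 0)) \<partial>lborel)"
proof -
  have int': "integrable (lborel \<Otimes>\<^sub>M lborel) (\<lambda>v. indicator S v * h v)"
    using int by (simp add: lborel_prod)
  have ae: "AE z in lborel. (\<integral>w. indicator S (z, w) * h (z, w) \<partial>lborel)
      = indicator D z * (of_real (pi * (r z)\<^sup>2) * h (z, 0))"
    using lborel_pair.AE_integrable_fst'[OF int']
  proof eventually_elim
    case (elim z)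
    show ?case
    proof (cases "z \<in> D")
      case True
      then have "(\<lambda>w. indicator S (z, w) * h (z, w)) = (\<lambda>w. indicator (ball 0 (r z)) w * h (z, w))"
        by (auto simp: fun_eq_iff indicator_def S)
      then show ?thesis
        using disc_mean[OF hol[OF True] _ r[OF True]] elim True by simp
    next
      case False
      then show ?thesis by (simp add: indicator_def S)
    qed
  qed
  have meas': "(\<lambda>z. \<integral>w. indicator S (z, w) * h (z, w) \<partial>lborel) \<in> borel_measurable lborel"
    using lborel_pair.integrable_fst'[OF int'] by (rule borel_measurable_integrable)
  show "integrable lborel (\<lambda>z. indicator D z * (of_real (pi * (r z)\<^sup>2) * h (z, 0)))"
    using lborel_pair.integrable_fst'[OF int'] integrable_cong_AE[OF meas' meas ae] by simp
  show "(\<integral>v. indicator S v * h v \<partial>lborel)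
      = (\<integral>z. indicator D z * (of_real (pi * (r z)\<^sup>2) * h (z, 0)) \<partial>lborel)"
    using lborel_pair.integral_fst'[OF int'] integral_cong_AE[OF meas' meas ae]
    by (simp add: lborel_prod)
qed

section \<open>The model domain and its test sets\<close>

definition punctured_bidisc :: "(complex \<times> complex) set" where "punctured_bidisc = punctured_disc \<times> punctured_disc"

definition xyprod :: "complex \<times> complex \<Rightarrow> complex" where "xyprod z = fst z * snd z"

definition weight :: "nat \<Rightarrow> real \<Rightarrow> complex \<times> complex \<Rightarrow> real" where
  "weight k e z = (if z \<in> punctured_bidisc \<and> cmod (xyprod z) < e then cmod (xyprod z) ^ k else 0)"

definition moment :: "nat \<Rightarrow> real \<Rightarrow> real" where
  "moment k e = (\<integral>z. weight k e z \<partial>lborel)"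

definition model_domain :: "((complex \<times> complex) \<times> complex) set" where
  "model_domain = {v. fst v \<in> punctured_bidisc \<and> cmod (snd v) < cmod (xyprod (fst v))}"

text \<open>
  The fibre over \<open>(x, y)\<close> is a disc whose area \<open>(\<pi>/2)(\<bar>q\<bar>\<^sup>2 + \<bar>q\<bar> Re q)\<close> is a trigonometric polynomial
  of degree one in the argument of \<open>q = xy\<close>.  It is this choice that makes the projection
  of the indicator a finite sum.
\<close>

definition test_set :: "real \<Rightarrow> ((complex \<times> complex) \<times> complex) set" where
  "test_set e = {v \<in> model_domain. cmod (xyprod (fst v)) < e \<and>
     2 * (cmod (snd v))\<^sup>2 < (cmod (xyprod (fst v)))\<^sup>2 + cmod (xyprod (fst v)) * Re (xyprod (fst v))}"

text \<open>
  The orthogonal expansion of the indicator of the test set in the monomials \<open>1\<close>, \<open>1/q\<close>, \<open>q\<close>.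
  The denominators are their squared norms and the numerators the inner products with the indicator,
  with common powers of \<open>\<pi>\<close> cancelled; the angular part \<open>Re q = (q + cnj q)/2\<close> accounts for 4 in
  place of 2.
\<close>

definition test_projection :: "real \<Rightarrow> complex \<times> complex \<Rightarrow> complex" where
  "test_projection e z = of_real (moment 2 e / (2 * moment 2 1))
     + of_real (moment 1 e / (4 * moment 0 1)) / xyprod z
     + of_real (moment 3 e / (4 * moment 4 1)) * xyprod z"

lemma continuous_xyprod [continuous_intros]: "continuous_on S f \<Longrightarrow> continuous_on S (\<lambda>x. xyprod (f x))"
  unfolding xyprod_def by (intro continuous_intros)

lemma xyprod_bounds: "z \<in> punctured_bidisc \<Longrightarrow> 0 < cmod (xyprod z)" "z \<in> punctured_bidisc \<Longrightarrow> cmod (xyprod z) < 1"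
  "z \<in> punctured_bidisc \<Longrightarrow> xyprod z \<noteq> 0"
proof -
  assume "z \<in> punctured_bidisc"
  then have z: "0 < cmod (fst z)" "cmod (fst z) < 1" "0 < cmod (snd z)" "cmod (snd z) < 1"
    by (auto simp: punctured_bidisc_def in_punctured_disc)
  then show 1: "0 < cmod (xyprod z)" by (simp add: xyprod_def norm_mult)
  then show "xyprod z \<noteq> 0" by auto
  from z have "cmod (fst z) * cmod (snd z) < 1 * 1"
    by (intro mult_strict_mono) auto
  then show "cmod (xyprod z) < 1" by (simp add: xyprod_def norm_mult)
qed

lemma open_punctured_bidisc: "open punctured_bidisc"
  unfolding punctured_bidisc_def by (intro open_Times open_punctured_disc)

lemma open_small: "open {z \<in> punctured_bidisc. cmod (xyprod z) < e}"
proof -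
  have "open (punctured_bidisc \<inter> {z. cmod (xyprod z) < e})"
    by (intro open_Int open_punctured_bidisc open_Collect_less continuous_intros)
  then show ?thesis by (simp add: Int_def)
qed

lemma open_model_domain: "open model_domain"
proof -
  have "model_domain = (punctured_bidisc \<times> UNIV) \<inter> {v. cmod (snd v) < cmod (xyprod (fst v))}"
    by (auto simp: model_domain_def)
  moreover have "open ((punctured_bidisc \<times> UNIV) \<inter> {v. cmod (snd v) < cmod (xyprod (fst v))})"
    by (intro open_Int open_Times open_punctured_bidisc open_Collect_less continuous_intros open_UNIV)
  ultimately show ?thesis by simp
qed

lemma bounded_punctured_bidisc: "bounded punctured_bidisc"
  unfolding punctured_bidisc_def punctured_disc_def by (intro bounded_Times) (auto intro: bounded_subset[OF bounded_ball])

lemma bounded_model_domain: "bounded model_domain"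
proof (rule bounded_subset)
  show "bounded (punctured_bidisc \<times> ball (0::complex) 1)"
    by (intro bounded_Times bounded_punctured_bidisc) auto
  show "model_domain \<subseteq> punctured_bidisc \<times> ball 0 1"
    by (auto simp: model_domain_def dest: xyprod_bounds(2))
qed

lemma zero_in_model_domain: "(z, 0) \<in> model_domain \<longleftrightarrow> z \<in> punctured_bidisc"
  by (auto simp: model_domain_def xyprod_bounds)

lemma test_set_subset: "test_set e \<subseteq> model_domain"
  by (auto simp: test_set_def)

lemma test_set_borel [measurable]: "test_set e \<in> sets borel"
proof -
  have "test_set e = model_domain \<inter> {v. cmod (xyprod (fst v)) < e} \<inter>
     {v. 2 * (cmod (snd v))\<^sup>2 < (cmod (xyprod (fst v)))\<^sup>2 + cmod (xyprod (fst v)) * Re (xyprod (fst v))}"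
    by (auto simp: test_set_def)
  moreover have "open \<dots>"
    by (intro open_Int open_model_domain open_Collect_less continuous_intros)
  ultimately show ?thesis by simp
qed

lemma integrable_bounded_on:
  fixes f :: "'a::euclidean_space \<Rightarrow> 'b::{banach, second_countable_topology}"
  assumes "open S" "bounded S" "continuous_on S f" "\<And>x. x \<in> S \<Longrightarrow> norm (f x) \<le> b"
  shows "integrable lborel (\<lambda>x. indicator S x *\<^sub>R f x)"
proof (rule Bochner_Integration.integrable_bound)
  show "integrable lborel (\<lambda>x. indicator S x * b)"
    using assms emeasure_bounded_finite[of S] by (intro integrable_mult_left) (auto intro: emeasure_bounded_finite[simplified])
  show "(\<lambda>x. indicator S x *\<^sub>R f x) \<in> borel_measurable lborel"
    using assms by (simp add: borel_measurable_continuous_on_indicator)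
  show "AE x in lborel. norm (indicator S x *\<^sub>R f x) \<le> norm (indicator S x * b)"
    using assms by (auto simp: indicator_def intro: order_trans[OF _ abs_ge_self])
qed

lemma weight_eq: "weight k e = (\<lambda>z. indicator {z \<in> punctured_bidisc. cmod (xyprod z) < e} z *\<^sub>R cmod (xyprod z) ^ k)"
  by (auto simp: weight_def fun_eq_iff)

lemma integrable_weight: "integrable lborel (weight k e)"
  unfolding weight_eq
proof (rule integrable_bounded_on[OF open_small])
  show "bounded {z \<in> punctured_bidisc. cmod (xyprod z) < e}"
    by (rule bounded_subset[OF bounded_punctured_bidisc]) auto
  show "continuous_on {z \<in> punctured_bidisc. cmod (xyprod z) < e} (\<lambda>z. cmod (xyprod z) ^ k)"
    by (intro continuous_intros)
  show "norm (cmod (xyprod z) ^ k) \<le> 1" if "z \<in> {z \<in> punctured_bidisc. cmod (xyprod z) < e}" for z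
    using that xyprod_bounds(2)[of z] by (simp add: power_le_one)
qed

text \<open>
  The radial weights pick out the torus mean, and what remains is a moment.
\<close>

lemma weight_torus_integral:
  fixes F :: "complex \<times> complex \<Rightarrow> complex"
  assumes mean: "\<And>x y. x \<in> punctured_disc \<Longrightarrow> y \<in> punctured_disc \<Longrightarrow>
      (\<integral>p. F (turn (fst p) * x, turn (snd p) * y) \<partial>(turns \<Otimes>\<^sub>M turns)) = A"
    and int: "integrable lborel (\<lambda>z. of_real (weight k e z) * F z)"
  shows "(\<integral>z. of_real (weight k e z) * F z \<partial>lborel) = A * of_real (moment k e)"
proof -
  have "(\<integral>z. of_real (weight k e z) * F z \<partial>lborel) = A * (\<integral>z. of_real (weight k e z) \<partial>lborel)"
  proof (rule integral_torus_average[OF _ _ mean int])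
    show "of_real (weight k e (c * x, d * y)) = (of_real (weight k e (x, y)) :: complex)"
      if "cmod c = 1" "cmod d = 1" for c d x y
      using that by (simp add: weight_def punctured_bidisc_def in_punctured_disc xyprod_def norm_mult)
    show "of_real (weight k e (x, y)) = (0::complex)" if "\<not> (x \<in> punctured_disc \<and> y \<in> punctured_disc)" for x y
      using that by (auto simp: weight_def punctured_bidisc_def)
  qed
  also have "(\<integral>z. of_real (weight k e z) \<partial>lborel) = complex_of_real (moment k e)"
    unfolding moment_def by (rule integral_complex_of_real)
  finally show ?thesis .
qed

text \<open>
  The fibre area \<open>\<pi>\<bar>q\<bar>\<^sup>2\<close> cancels the singularity of \<open>1/\<bar>q\<bar>\<^sup>2\<close> exactly.
\<close>

lemma integrable_inverse_square:
  "integrable lborel (\<lambda>v. indicator model_domain v * (cmod (1 / xyprod (fst v)))\<^sup>2)"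
proof -
  let ?f = "\<lambda>v. indicator model_domain v * (cmod (1 / xyprod (fst v)))\<^sup>2"
  have f: "?f (z, w) = (if z \<in> punctured_bidisc then indicator (ball 0 (cmod (xyprod z))) w * (1 / cmod (xyprod z))\<^sup>2 else 0)" for z w
    by (auto simp: model_domain_def indicator_def norm_divide)
  have meas: "?f \<in> borel_measurable borel"
  proof -
    have "(\<lambda>v. indicator model_domain v *\<^sub>R (cmod (1 / xyprod (fst v)))\<^sup>2) \<in> borel_measurable borel"
      by (intro borel_measurable_continuous_on_indicator continuous_intros open_model_domain borel_open)
        (auto simp: model_domain_def dest: xyprod_bounds)
    then show ?thesis by simp
  qed
  have int: "integrable lborel (\<lambda>w. ?f (z, w))" for z
    unfolding f using emeasure_bounded_finite[OF bounded_ball, of "0::complex" "cmod (xyprod z)"]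
    by (cases "z \<in> punctured_bidisc") simp_all
  have "(\<integral>w. norm (?f (z, w)) \<partial>lborel) = indicator punctured_bidisc z * pi" for z
  proof (cases "z \<in> punctured_bidisc")
    case True
    then have "(\<integral>w. norm (?f (z, w)) \<partial>lborel)
        = (\<integral>w. indicator (ball (0::complex) (cmod (xyprod z))) w * (1 / cmod (xyprod z))\<^sup>2 \<partial>lborel)"
      unfolding f by (intro Bochner_Integration.integral_cong) auto
    also have "\<dots> = measure lborel (ball (0::complex) (cmod (xyprod z))) * (1 / cmod (xyprod z))\<^sup>2"
      by simp
    also have "\<dots> = pi"
      using xyprod_bounds[OF True] by (subst measure_disc) (auto simp: field_simps power2_eq_square)
    finally show ?thesis using True by simp
  next
    case False
    then show ?thesis unfolding f by simp
  qed
  moreover have "integrable lborel (\<lambda>z. indicator punctured_bidisc z * pi)"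
    using integrable_bounded_on[OF open_punctured_bidisc bounded_punctured_bidisc continuous_on_const, of pi pi] by simp
  ultimately have "integrable (lborel \<Otimes>\<^sub>M lborel) ?f"
    using meas int by (intro lborel_pair.Fubini_integrable) (simp_all add: lborel_prod)
  then show ?thesis by (simp add: lborel_prod)
qed

lemma integrable_L2_product:
  fixes f g :: "'a \<Rightarrow> complex"
  assumes "f \<in> borel_measurable M" "g \<in> borel_measurable M"
    "integrable M (\<lambda>x. (cmod (f x))\<^sup>2)" "integrable M (\<lambda>x. (cmod (g x))\<^sup>2)"
  shows "integrable M (\<lambda>x. f x * g x)"
proof (rule Bochner_Integration.integrable_bound)
  show "integrable M (\<lambda>x. (cmod (f x))\<^sup>2 + (cmod (g x))\<^sup>2)"
    using assms by simp
  show "(\<lambda>x. f x * g x) \<in> borel_measurable M"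
    using assms by simp
  have "norm (f x * g x) \<le> norm ((cmod (f x))\<^sup>2 + (cmod (g x))\<^sup>2)" for x
  proof -
    have "0 \<le> cmod (f x) * cmod (g x)"
      by simp
    with sum_squares_bound[of "cmod (f x)" "cmod (g x)"]
    have "cmod (f x) * cmod (g x) \<le> (cmod (f x))\<^sup>2 + (cmod (g x))\<^sup>2"
      by linarith
    then show ?thesis by (simp add: norm_mult)
  qed
  then show "AE x in M. norm (f x * g x) \<le> norm ((cmod (f x))\<^sup>2 + (cmod (g x))\<^sup>2)"
    by simp
qed

lemma test_set_fiber:
  assumes z: "z \<in> punctured_bidisc" and r: "r = (if cmod (xyprod z) < e then sqrt (((cmod (xyprod z))\<^sup>2 + cmod (xyprod z) * Re (xyprod z)) / 2) else 0)"
  shows "(z, w) \<in> test_set e \<longleftrightarrow> cmod w < r" "0 \<le> r" "r \<le> cmod (xyprod z)"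
proof -
  define s where "s = (cmod (xyprod z))\<^sup>2 + cmod (xyprod z) * Re (xyprod z)"
  have re: "\<bar>cmod (xyprod z) * Re (xyprod z)\<bar> \<le> (cmod (xyprod z))\<^sup>2"
    using mult_left_mono[OF abs_Re_le_cmod[of "xyprod z"], of "cmod (xyprod z)"]
    by (simp add: power2_eq_square abs_mult)
  then have s: "0 \<le> s" "s / 2 \<le> (cmod (xyprod z))\<^sup>2"
    by (auto simp: s_def)
  have le: "sqrt (s / 2) \<le> cmod (xyprod z)"
    using s by (simp add: real_le_lsqrt)
  show "0 \<le> r" "r \<le> cmod (xyprod z)"
    using s le by (auto simp: r s_def[symmetric])
  have "2 * (cmod w)\<^sup>2 < s \<longleftrightarrow> cmod w < sqrt (s / 2)"
    using real_sqrt_less_iff[of "(cmod w)\<^sup>2" "s / 2"] by auto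
  then show "(z, w) \<in> test_set e \<longleftrightarrow> cmod w < r"
    using z le by (auto simp: test_set_def model_domain_def r s_def[symmetric])
qed


lemma fiber_integral_product:
  fixes h :: "(complex \<times> complex) \<times> complex \<Rightarrow> complex" and m :: "complex \<times> complex \<Rightarrow> complex"
  assumes cont: "continuous_on model_domain h"
    and hw: "\<And>z. (\<lambda>w. h (z, w)) holomorphic_on {w. (z, w) \<in> model_domain}"
    and L2: "integrable lborel (\<lambda>v. indicator model_domain v * (cmod (h v))\<^sup>2)"
    and m: "continuous_on punctured_bidisc m" "integrable lborel (\<lambda>v. indicator model_domain v * (cmod (m (fst v)))\<^sup>2)"
  shows "integrable lborel (\<lambda>v. indicator model_domain v * (m (fst v) * h v))"
    and "integrable lborel (\<lambda>z. indicator punctured_bidisc z * (of_real (pi * (cmod (xyprod z))\<^sup>2) * (m z * h (z, 0))))"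
    and "(\<integral>v. indicator model_domain v * (m (fst v) * h v) \<partial>lborel)
      = (\<integral>z. indicator punctured_bidisc z * (of_real (pi * (cmod (xyprod z))\<^sup>2) * (m z * h (z, 0))) \<partial>lborel)"
proof -
  have "integrable lborel (\<lambda>v. (indicator model_domain v *\<^sub>R m (fst v)) * (indicator model_domain v *\<^sub>R h v))"
  proof (rule integrable_L2_product)
    show "(\<lambda>v. indicator model_domain v *\<^sub>R m (fst v)) \<in> borel_measurable lborel"
      unfolding measurable_lborel2
      by (intro borel_measurable_continuous_on_indicator borel_open open_model_domain
          continuous_on_compose2[OF m(1)] continuous_intros) (auto simp: model_domain_def)
    show "(\<lambda>v. indicator model_domain v *\<^sub>R h v) \<in> borel_measurable lborel"
      unfolding measurable_lborel2
      by (intro borel_measurable_continuous_on_indicator borel_open open_model_domain cont)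
    have 1: "(cmod (indicator model_domain v *\<^sub>R u))\<^sup>2 = indicator model_domain v * (cmod u)\<^sup>2" for v u
      by (simp add: indicator_def)
    show "integrable lborel (\<lambda>v. (cmod (indicator model_domain v *\<^sub>R m (fst v)))\<^sup>2)"
      "integrable lborel (\<lambda>v. (cmod (indicator model_domain v *\<^sub>R h v))\<^sup>2)"
      unfolding 1 by (rule m(2) L2)+
  qed
  moreover have "(\<lambda>v. (indicator model_domain v *\<^sub>R m (fst v)) * (indicator model_domain v *\<^sub>R h v))
      = (\<lambda>v. indicator model_domain v * (m (fst v) * h v))"
    by (auto simp: fun_eq_iff indicator_def)
  ultimately show int: "integrable lborel (\<lambda>v. indicator model_domain v * (m (fst v) * h v))"
    by simp
  let ?k = "\<lambda>v. m (fst v) * h v"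
  have fib: "{w. (z, w) \<in> model_domain} = ball 0 (cmod (xyprod z))" if "z \<in> punctured_bidisc" for z
    using that by (auto simp: model_domain_def)
  have S: "(z, w) \<in> model_domain \<longleftrightarrow> z \<in> punctured_bidisc \<and> cmod w < cmod (xyprod z)" for z w
    by (simp add: model_domain_def)
  have hol: "(\<lambda>w. ?k (z, w)) holomorphic_on ball 0 (cmod (xyprod z))" if "z \<in> punctured_bidisc" for z
    using hw[of z] unfolding fib[OF that] by (auto intro!: holomorphic_intros)
  have "(\<lambda>z. indicator punctured_bidisc z *\<^sub>R (of_real (pi * (cmod (xyprod z))\<^sup>2) * (m z * h (z, 0)))) \<in> borel_measurable lborel"
    unfolding measurable_lborel2
    by (intro borel_measurable_continuous_on_indicator borel_open open_punctured_bidisc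
          continuous_on_compose2[OF cont] m(1) continuous_intros) (auto simp: zero_in_model_domain)
  moreover have "(\<lambda>z. indicator punctured_bidisc z *\<^sub>R (of_real (pi * (cmod (xyprod z))\<^sup>2) * (m z * h (z, 0))))
     = (\<lambda>z. indicator punctured_bidisc z * (of_real (pi * (cmod (xyprod z))\<^sup>2) * (m z * h (z, 0))))"
    by (auto simp: fun_eq_iff indicator_def)
  ultimately have meas: "(\<lambda>z. indicator punctured_bidisc z * (of_real (pi * (cmod (xyprod z))\<^sup>2) * ?k (z, 0))) \<in> borel_measurable lborel"
    by simp
  show "integrable lborel (\<lambda>z. indicator punctured_bidisc z * (of_real (pi * (cmod (xyprod z))\<^sup>2) * (m z * h (z, 0))))"
    "(\<integral>v. indicator model_domain v * (m (fst v) * h v) \<partial>lborel)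
      = (\<integral>z. indicator punctured_bidisc z * (of_real (pi * (cmod (xyprod z))\<^sup>2) * (m z * h (z, 0))) \<partial>lborel)"
    using fiber_integral[OF int S hol _ meas] by simp_all
qed

section \<open>Size of the moments\<close>

definition dyadic_annulus :: "real \<Rightarrow> complex set" where "dyadic_annulus a = ball 0 a - ball 0 (a / 2)"

lemma measure_dyadic_annulus:
  assumes "a \<ge> 0"
  shows "measure lborel (dyadic_annulus a) = pi * (3 / 4) * a\<^sup>2"
proof -
  have "measure lborel (dyadic_annulus a) = measure lborel (ball (0::complex) a) - measure lborel (ball (0::complex) (a / 2))"
    unfolding dyadic_annulus_def using assms emeasure_bounded_finite[OF bounded_ball, of "0::complex" a]
    by (intro measure_Diff) (auto simp: less_top)
  then show ?thesis
    using assms by (simp only: measure_disc) (simp add: measure_disc power2_eq_square)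
qed

text \<open>
  The logarithm in the volume of \<open>{\<bar>q\<bar> < e}\<close> appears here as the factor \<open>N + 1\<close>: in the \<open>j\<close>-th piece
  \<open>\<bar>x\<bar>\<close> is comparable to \<open>2\<^sup>-\<^sup>j\<close> and \<open>\<bar>y\<bar>\<close> to \<open>e 2\<^sup>j\<close>, so \<open>\<bar>xy\<bar>\<close> lies between \<open>e/4\<close> and \<open>e\<close>, and all
  pieces have the same measure.
\<close>

lemma moment_ge:
  assumes e: "e = (1 / 2) ^ N"
  shows "moment k e \<ge> (real N + 1) * (9 / 16 * pi\<^sup>2 * e\<^sup>2) * (e / 4) ^ k"
proof -
  have e0: "e > 0" by (simp add: e)
  define R where "R = (\<lambda>j::nat. dyadic_annulus (1 / 2 ^ j) \<times> dyadic_annulus (e * 2 ^ j))"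
  have R_borel: "R j \<in> sets borel" for j
    unfolding R_def dyadic_annulus_def by (intro borel_Times) auto
  have R_iff: "z \<in> R j \<longleftrightarrow> 1 / 2 ^ j / 2 \<le> cmod (fst z) \<and> cmod (fst z) < 1 / 2 ^ j \<and>
      e * 2 ^ j / 2 \<le> cmod (snd z) \<and> cmod (snd z) < e * 2 ^ j" for z j
    by (cases z) (auto simp: R_def dyadic_annulus_def not_less)
  have R_measure: "emeasure lborel (R j) = ennreal (9 / 16 * pi\<^sup>2 * e\<^sup>2)" for j
  proof -
    have fin: "emeasure lborel (dyadic_annulus a) = ennreal (measure lborel (dyadic_annulus a))" for a
      using emeasure_bounded_finite[of "dyadic_annulus a"]
      by (intro emeasure_eq_ennreal_measure) (auto simp: dyadic_annulus_def less_top[symmetric] intro: bounded_subset[OF bounded_ball])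
    have "emeasure lborel (R j) = emeasure lborel (dyadic_annulus (1 / 2 ^ j)) * emeasure lborel (dyadic_annulus (e * 2 ^ j))"
      unfolding R_def lborel_prod[symmetric]
      by (rule lborel.emeasure_pair_measure_Times) (auto simp: dyadic_annulus_def)
    also have "\<dots> = ennreal (measure lborel (dyadic_annulus (1 / 2 ^ j)) * measure lborel (dyadic_annulus (e * 2 ^ j)))"
      unfolding fin by (simp add: ennreal_mult)
    also have "measure lborel (dyadic_annulus (1 / 2 ^ j)) * measure lborel (dyadic_annulus (e * 2 ^ j)) = 9 / 16 * pi\<^sup>2 * e\<^sup>2"
      using e0 by (simp add: measure_dyadic_annulus power_mult_distrib power_divide field_simps power2_eq_square)
    finally show ?thesis .
  qed
  have disj: "disjoint_family_on R {..N}"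
  proof -
    have "R i \<inter> R j = {}" if "i < j" for i j
    proof -
      have "(1::real) / 2 ^ j \<le> 1 / 2 ^ Suc i"
        using that by (intro divide_left_mono power_increasing) auto
      then show ?thesis
        by (auto simp: R_iff)
    qed
    then show ?thesis
      unfolding disjoint_family_on_def by (metis Int_commute linorder_neqE_nat)
  qed
  have le: "(\<Sum>j\<le>N. indicator (R j) z * (e / 4) ^ k) \<le> weight k e z" for z
  proof -
    have "(\<Sum>j\<le>N. indicator (R j) z * (e / 4) ^ k) = indicator (\<Union>j\<le>N. R j) z * (e / 4) ^ k"
      unfolding indicator_UN_disjoint[OF finite_atMost disj] sum_distrib_right ..
    also have "\<dots> \<le> weight k e z"
    proof (cases "z \<in> (\<Union>j\<le>N. R j)")
      case True
      then obtain j where j: "j \<le> N" "z \<in> R j" by auto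
      then have x: "1 / 2 ^ j / 2 \<le> cmod (fst z)" "cmod (fst z) < 1 / 2 ^ j"
        and y: "e * 2 ^ j / 2 \<le> cmod (snd z)" "cmod (snd z) < e * 2 ^ j"
        unfolding R_iff by auto
      have x1: "0 < cmod (fst z)"
        by (rule less_le_trans[OF _ x(1)]) simp
      have y1: "0 < cmod (snd z)"
        by (rule less_le_trans[OF _ y(1)]) (simp add: e0)
      have "(1::real) / 2 ^ j \<le> 1" by simp
      then have x2: "cmod (fst z) < 1" using x(2) by linarith
      have "e * 2 ^ j \<le> e * 2 ^ N"
        using e0 j by (intro mult_left_mono power_increasing) auto
      also have "\<dots> = 1" by (simp add: e power_one_over)
      finally have y2: "cmod (snd z) < 1" using y(2) by linarith
      have bi: "z \<in> punctured_bidisc"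
        using x1 x2 y1 y2 by (cases z) (simp add: punctured_bidisc_def in_punctured_disc)
      have "cmod (fst z) * cmod (snd z) < (1 / 2 ^ j) * (e * 2 ^ j)"
        using x y x1 y1 by (intro mult_strict_mono) auto
      then have q1: "cmod (xyprod z) < e" by (simp add: xyprod_def norm_mult)
      have "(1 / 2 ^ j / 2) * (e * 2 ^ j / 2) \<le> cmod (fst z) * cmod (snd z)"
        using x y e0 by (intro mult_mono) auto
      then have "e / 4 \<le> cmod (xyprod z)" by (simp add: xyprod_def norm_mult)
      then have "(e / 4) ^ k \<le> cmod (xyprod z) ^ k"
        using e0 by (intro power_mono) auto
      then show ?thesis using True bi q1 by (simp add: weight_def)
    next
      case False
      then show ?thesis by (simp add: weight_def)
    qed
    finally show ?thesis .
  qed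
  have int: "integrable lborel (\<lambda>z. indicator (R j) z * (e / 4) ^ k)" for j
    using R_measure[of j] R_borel[of j] by simp
  have "(\<integral>z. (\<Sum>j\<le>N. indicator (R j) z * (e / 4) ^ k) \<partial>lborel) \<le> moment k e"
    unfolding moment_def by (intro integral_mono Bochner_Integration.integrable_sum int integrable_weight le)
  also have "(\<integral>z. (\<Sum>j\<le>N. indicator (R j) z * (e / 4) ^ k) \<partial>lborel)
      = (\<Sum>j\<le>N. \<integral>z. indicator (R j) z * (e / 4) ^ k \<partial>lborel)"
    by (intro Bochner_Integration.integral_sum int)
  also have "\<dots> = (\<Sum>j\<le>N. (9 / 16 * pi\<^sup>2 * e\<^sup>2) * (e / 4) ^ k)"
    using R_borel by (simp add: measure_def R_measure)
  also have "\<dots> = (real N + 1) * (9 / 16 * pi\<^sup>2 * e\<^sup>2) * (e / 4) ^ k"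
    by (simp add: algebra_simps)
  finally show ?thesis .
qed

lemma moment_pos: "moment k ((1 / 2) ^ N) > 0"
  by (rule less_le_trans[OF _ moment_ge[OF refl]]) simp

lemma moment_1_pos: "moment k 1 > 0"
  using moment_pos[of k 0] by simp

lemma moment_Suc_le:
  assumes "e \<ge> 0"
  shows "moment (Suc k) e \<le> e * moment k e"
proof -
  have "moment (Suc k) e \<le> (\<integral>z. e * weight k e z \<partial>lborel)"
    unfolding moment_def using assms
    by (intro integral_mono integrable_mult_right integrable_weight)
      (auto simp: weight_def intro!: mult_right_mono)
  then show ?thesis by (simp add: moment_def)
qed

lemma emeasure_test_set_le: "emeasure lborel (test_set e) \<le> ennreal (pi * moment 2 e)"
proof -
  have "test_set e \<in> sets (lborel \<Otimes>\<^sub>M lborel)"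
    unfolding lborel_prod using test_set_borel by simp
  then have "emeasure (lborel \<Otimes>\<^sub>M lborel) (test_set e)
      = (\<integral>\<^sup>+z. emeasure lborel (Pair z -` test_set e) \<partial>lborel)"
    by (rule lborel.emeasure_pair_measure_alt)
  then have "emeasure lborel (test_set e) = (\<integral>\<^sup>+z. emeasure lborel (Pair z -` test_set e) \<partial>lborel)"
    unfolding lborel_prod .
  also have "\<dots> \<le> (\<integral>\<^sup>+z. ennreal (pi * weight 2 e z) \<partial>lborel)"
  proof (rule nn_integral_mono)
    fix z :: "complex \<times> complex"
    show "emeasure lborel (Pair z -` test_set e) \<le> ennreal (pi * weight 2 e z)"
    proof (cases "z \<in> punctured_bidisc \<and> cmod (xyprod z) < e")
      case True
      have "emeasure lborel (Pair z -` test_set e) \<le> emeasure lborel (ball (0::complex) (cmod (xyprod z)))"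
        by (intro emeasure_mono) (auto simp: test_set_def model_domain_def)
      also have "\<dots> = ennreal (measure lborel (ball (0::complex) (cmod (xyprod z))))"
        using emeasure_bounded_finite[OF bounded_ball, of "0::complex" "cmod (xyprod z)"]
        by (intro emeasure_eq_ennreal_measure) (auto simp: less_top[symmetric])
      also have "\<dots> = ennreal (pi * weight 2 e z)"
        using True by (subst measure_disc) (auto simp: weight_def)
      finally show ?thesis .
    next
      case False
      then have "Pair z -` test_set e = {}" by (auto simp: test_set_def model_domain_def)
      then show ?thesis by simp
    qed
  qed
  also have "\<dots> = ennreal (\<integral>z. pi * weight 2 e z \<partial>lborel)"
    by (rule nn_integral_eq_integral, intro integrable_mult_right integrable_weight)
      (auto simp: weight_def)
  finally show ?thesis by (simp add: moment_def)
qed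

text \<open>
  Here \<open>K\<close> stands for the power of the supposed constant in the weak type estimate and \<open>V\<close> for
  the volume of the domain; the last inequality contradicts that estimate at level \<open>y\<close>.
  With \<open>M = moment 2 e\<close>, the level \<open>y\<close> is at least \<open>M / (8 I\<^sub>0 e)\<close> for the
  constant \<open>I\<^sub>0 = moment 0 1\<close>, so it suffices that \<open>M / e\<^sup>4\<close> be large.
\<close>

theorem weak_type_bound_violated:
  fixes K V :: real
  assumes K: "K > 0" and V: "V > 0"
  obtains e y where "0 < y" "\<And>z. z \<in> punctured_bidisc \<Longrightarrow> y < cmod (test_projection e z)"
    "K * (pi * moment 2 e) < V * y powr (4 / 3)"
proof -
  define i0 i2 i4 where "i0 = moment 0 1" and "i2 = moment 2 1" and "i4 = moment 4 1"
  have i: "i0 > 0" "i2 > 0" "i4 > 0"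
    using moment_1_pos by (auto simp: i0_def i2_def i4_def)
  define s where "s = 2 * i0 / i2 + i0 / i4"
  have s: "s > 0"
    unfolding s_def using i by (intro add_pos_pos divide_pos_pos) auto
  \<comment> \<open>For e below d the coefficients c0 and c2 together are at most half of c1.\<close>
  define d where "d = 1 / (2 * s)"
  have d: "d > 0" "d * s = 1 / 2"
    using s by (auto simp: d_def)
  \<comment> \<open>It suffices that the cube root of M / e^4, called m below, exceeds L.\<close>
  define L where "L = K * pi * (8 * i0) powr (4 / 3) / V"
  have L: "L \<ge> 0" using K V by (simp add: L_def)
  have "eventually (\<lambda>N. (1 / 2 :: real) ^ N < d) sequentially"
    by (rule order_tendstoD(2)[OF LIMSEQ_power_zero d(1)]) simp
  moreover have "eventually (\<lambda>N. real N > 256 / (9 * pi\<^sup>2) * L ^ 3) sequentially"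
    using filterlim_real_sequentially unfolding filterlim_at_top_dense by blast
  ultimately have "eventually (\<lambda>N. (1 / 2 :: real) ^ N < d \<and> real N > 256 / (9 * pi\<^sup>2) * L ^ 3) sequentially"
    by (rule eventually_conj)
  then obtain N where N: "(1 / 2 :: real) ^ N < d" "real N > 256 / (9 * pi\<^sup>2) * L ^ 3"
    by (auto simp: eventually_sequentially)
  define e :: real where "e = (1 / 2) ^ N"
  have e: "0 < e" "e \<le> 1" "e < d"
    using N by (auto simp: e_def power_le_one)
  define c0 c1 c2 where "c0 = moment 2 e / (2 * i2)" and "c1 = moment 1 e / (4 * i0)"
    and "c2 = moment 3 e / (4 * i4)"
  have mpos: "moment k e > 0" for k
    unfolding e_def by (rule moment_pos)
  have c: "c0 > 0" "c1 > 0" "c2 > 0"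
    using mpos i by (auto simp: c0_def c1_def c2_def)
  have m2: "moment 2 e \<le> e * moment 1 e"
    using moment_Suc_le[of e 1] e by (simp add: numeral_2_eq_2)
  have m3: "moment 3 e \<le> e * moment 1 e"
  proof -
    have "moment 3 e \<le> e * moment 2 e"
      using moment_Suc_le[of e 2] e by (simp add: numeral_3_eq_3 numeral_2_eq_2)
    also have "\<dots> \<le> 1 * moment 2 e"
      using e mpos[of 2] by (intro mult_right_mono) auto
    finally show ?thesis using m2 by simp
  qed
  have "c0 \<le> e * moment 1 e / (2 * i2)"
    unfolding c0_def using m2 i by (intro divide_right_mono) auto
  also have "\<dots> = e * (2 * i0 / i2) * c1"
    using i by (simp add: c1_def field_simps)
  finally have c0: "c0 \<le> e * (2 * i0 / i2) * c1" .
  have "c2 \<le> e * moment 1 e / (4 * i4)"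
    unfolding c2_def using m3 i by (intro divide_right_mono) auto
  also have "\<dots> = e * (i0 / i4) * c1"
    using i by (simp add: c1_def field_simps)
  finally have "c0 + c2 \<le> e * s * c1"
    using c0 by (simp add: s_def algebra_simps)
  also have "\<dots> \<le> d * s * c1"
    using e s c by (intro mult_right_mono) auto
  finally have c02: "c0 + c2 \<le> c1 / 2"
    unfolding d by simp
  have big: "c1 / 2 < cmod (test_projection e z)" if z: "z \<in> punctured_bidisc" for z
  proof -
    have q: "0 < cmod (xyprod z)" "cmod (xyprod z) < 1"
      using xyprod_bounds[OF z] by simp_all
    have "c1 < c1 / cmod (xyprod z)"
      using mult_strict_left_mono[OF q(2) c(2)] by (subst pos_less_divide_eq[OF q(1)]) simp
    also have "\<dots> = cmod (of_real c1 / xyprod z)"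
      using c by (simp add: norm_divide)
    finally have 1: "c1 < cmod (of_real c1 / xyprod z)" .
    have "c2 * cmod (xyprod z) \<le> c2 * 1"
      using c q by (intro mult_left_mono) auto
    then have 2: "cmod (of_real c2 * xyprod z) \<le> c2"
      using c by (simp add: norm_mult)
    have 3: "cmod (of_real c0) = c0" using c by simp
    have "test_projection e z = of_real c1 / xyprod z - (- (of_real c0 + of_real c2 * xyprod z))"
      by (simp add: test_projection_def c0_def c1_def c2_def i0_def i2_def i4_def)
    then have "cmod (of_real c1 / xyprod z) - cmod (of_real c0 + of_real c2 * xyprod z) \<le> cmod (test_projection e z)"
      by (metis norm_minus_cancel norm_triangle_ineq2)
    moreover have "cmod (of_real c0 + of_real c2 * xyprod z) \<le> c0 + c2"
      using norm_triangle_ineq[of "of_real c0" "of_real c2 * xyprod z"] 2 3 by linarith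
    ultimately show ?thesis using 1 c02 by linarith
  qed
  define m where "m = moment 2 e / e ^ 4"
  have m_eq: "moment 2 e = m * e ^ 4" using e by (simp add: m_def)
  have m0: "m > 0" using mpos e by (simp add: m_def)
  have "(real N + 1) * (9 / 16 * pi\<^sup>2 * e\<^sup>2) * (e / 4)\<^sup>2 \<le> m * e ^ 4"
    using moment_ge[OF e_def, of 2] by (simp add: m_eq)
  also have "(real N + 1) * (9 / 16 * pi\<^sup>2 * e\<^sup>2) * (e / 4)\<^sup>2 = ((real N + 1) * (9 * pi\<^sup>2 / 256)) * e ^ 4"
    by (simp add: power2_eq_square power4_eq_xxxx)
  finally have "(real N + 1) * (9 * pi\<^sup>2 / 256) \<le> m"
    using e by simp
  moreover have "L ^ 3 < (real N + 1) * (9 * pi\<^sup>2 / 256)"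
    using N(2) by (simp add: field_simps) (smt (verit) pi_gt_zero zero_less_power)
  ultimately have "L ^ 3 < m" by linarith
  then have "L < m powr (1 / 3)"
  proof -
    assume *: "L ^ 3 < m"
    have "(m powr (1 / 3)) ^ 3 = m"
      using m0 by (simp add: powr_realpow[symmetric] powr_powr)
    then show ?thesis
      using * power_less_imp_less_base[of L 3 "m powr (1 / 3)"] by simp
  qed
  then have "L * m < m powr (1 / 3) * m"
    using m0 by simp
  also have "\<dots> = m powr (4 / 3)"
    using m0 powr_add[of m "1 / 3" 1] by simp
  finally have Lm: "L * m < m powr (4 / 3)" .
  have "K * (pi * moment 2 e) = L * m * (V * e ^ 4 / (8 * i0) powr (4 / 3))"
    using V i by (simp add: L_def m_eq)
  also have "\<dots> < m powr (4 / 3) * (V * e ^ 4 / (8 * i0) powr (4 / 3))"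
    using V i e by (intro mult_strict_right_mono Lm) auto
  also have "\<dots> = V * (m * e ^ 3 / (8 * i0)) powr (4 / 3)"
  proof -
    have "(e ^ 3) powr (4 / 3) = (e powr 3) powr (4 / 3)"
      using e by simp
    also have "\<dots> = e powr 4"
      by (simp only: powr_powr) simp
    also have "\<dots> = e ^ 4"
      using e by simp
    finally have e4: "(e ^ 3) powr (4 / 3) = e ^ 4" .
    have "(m * e ^ 3 / (8 * i0)) powr (4 / 3) = (m * e ^ 3) powr (4 / 3) / (8 * i0) powr (4 / 3)"
      by (rule powr_divide)
    also have "(m * e ^ 3) powr (4 / 3) = m powr (4 / 3) * e ^ 4"
      unfolding e4[symmetric] by (rule powr_mult)
    finally show ?thesis
      by (simp only: mult_ac times_divide_eq_right times_divide_eq_left)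
  qed
  also have "\<dots> \<le> V * (c1 / 2) powr (4 / 3)"
  proof -
    have "m * e ^ 4 \<le> e * moment 1 e" using m2 by (simp add: m_eq)
    then have "e * (m * e ^ 3) \<le> e * moment 1 e"
      by (simp add: power4_eq_xxxx power3_eq_cube mult_ac)
    then have "m * e ^ 3 \<le> moment 1 e"
      using e by simp
    then have "m * e ^ 3 / (8 * i0) \<le> c1 / 2"
      using i by (simp add: c1_def divide_right_mono)
    then show ?thesis
      using V m0 e i by (intro mult_left_mono powr_mono2) auto
  qed
  finally show thesis
    using that[of "c1 / 2" e] big c by simp
qed

section \<open>Orthogonality on the model domain\<close>

lemma weight_bounds: "0 \<le> weight k e z" "weight k e z \<le> 1"
  by (auto simp: weight_def intro!: power_le_one dest: xyprod_bounds)

lemma integrable_weight_mult: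
  fixes f :: "complex \<times> complex \<Rightarrow> complex"
  assumes "integrable lborel f"
  shows "integrable lborel (\<lambda>z. of_real (weight k e z) * f z)"
proof (rule Bochner_Integration.integrable_bound[OF assms])
  have "weight k e \<in> borel_measurable lborel"
    using integrable_weight by (rule borel_measurable_integrable)
  then show "(\<lambda>z. of_real (weight k e z) * f z) \<in> borel_measurable lborel"
    using assms by measurable
  show "AE z in lborel. norm (of_real (weight k e z) * f z) \<le> norm (f z)"
    using weight_bounds by (auto simp: norm_mult mult_left_le_one_le)
qed

lemma square_integrable_monomials:
  "integrable lborel (\<lambda>v. indicator model_domain v * (cmod 1)\<^sup>2)"
  "integrable lborel (\<lambda>v. indicator model_domain v * (cmod (xyprod (fst v)))\<^sup>2)"
proof -
  show "integrable lborel (\<lambda>v. indicator model_domain v * (cmod 1)\<^sup>2)"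
    using integrable_bounded_on[OF open_model_domain bounded_model_domain continuous_on_const, of "1::real" 1] by simp
  have "integrable lborel (\<lambda>v. indicator model_domain v *\<^sub>R (cmod (xyprod (fst v)))\<^sup>2)"
  proof (rule integrable_bounded_on[OF open_model_domain bounded_model_domain])
    show "continuous_on model_domain (\<lambda>v. (cmod (xyprod (fst v)))\<^sup>2)"
      by (intro continuous_intros)
    show "norm ((cmod (xyprod (fst v)))\<^sup>2) \<le> 1" if "v \<in> model_domain" for v
      using that xyprod_bounds(2)[of "fst v"] by (auto simp: model_domain_def power_le_one)
  qed
  then show "integrable lborel (\<lambda>v. indicator model_domain v * (cmod (xyprod (fst v)))\<^sup>2)"
    by simp
qed

text \<open>
  The function \<open>test_projection e\<close> is the orthogonal projection of the indicator of the test set: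
  both have the same pairing with every square integrable holomorphic \<open>h\<close>.  On both sides the fibre
  variable is integrated out, which leaves \<open>H (x, y) = h ((x, y), 0)\<close> against radial weights times
  \<open>1\<close>, \<open>q\<close> or \<open>1/q\<close>.  Each side is then a combination of the torus means of \<open>H\<close>, \<open>qH\<close> and \<open>H/q\<close>,
  and the coefficients agree by the choice of the coefficients of \<open>test_projection\<close>.
\<close>

theorem bergman_identity:
  fixes h :: "(complex \<times> complex) \<times> complex \<Rightarrow> complex"
  assumes cont: "continuous_on model_domain h"
    and hx: "\<And>y w. (\<lambda>x. h ((x, y), w)) holomorphic_on {x. ((x, y), w) \<in> model_domain}"
    and hy: "\<And>x w. (\<lambda>y. h ((x, y), w)) holomorphic_on {y. ((x, y), w) \<in> model_domain}"
    and hw: "\<And>z. (\<lambda>w. h (z, w)) holomorphic_on {w. (z, w) \<in> model_domain}"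
    and L2: "integrable lborel (\<lambda>v. indicator model_domain v * (cmod (h v))\<^sup>2)"
  shows "integrable lborel (\<lambda>v. indicator (test_set e) v * h v)"
    and "integrable lborel (\<lambda>v. indicator model_domain v * (cnj (test_projection e (fst v)) * h v))"
    and "(\<integral>v. indicator (test_set e) v * h v \<partial>lborel)
      = (\<integral>v. indicator model_domain v * (cnj (test_projection e (fst v)) * h v) \<partial>lborel)"
proof -
  define H where "H = (\<lambda>z. h (z, 0))"
  have contH: "continuous_on punctured_bidisc H"
    unfolding H_def by (intro continuous_on_compose2[OF cont] continuous_intros) (auto simp: zero_in_model_domain)
  have holHx: "(\<lambda>x. H (x, y)) holomorphic_on punctured_disc" if "y \<in> punctured_disc" for y
    using hx[of y 0] that by (simp add: H_def zero_in_model_domain punctured_bidisc_def)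
  have holHy: "(\<lambda>y. H (x, y)) holomorphic_on punctured_disc" if "x \<in> punctured_disc" for x
    using hy[of x 0] that by (simp add: H_def zero_in_model_domain punctured_bidisc_def)
  define mean where "mean = (\<lambda>F A. \<forall>x\<in>punctured_disc. \<forall>y\<in>punctured_disc.
    (\<integral>p. F (turn (fst p) * x, turn (snd p) * y) \<partial>(turns \<Otimes>\<^sub>M turns)) = (A::complex))"
  have nz: "x \<noteq> 0" if "x \<in> punctured_disc" for x using that by (auto simp: punctured_disc_def)
  have mean_ex: "\<exists>A. mean F A"
    if F: "continuous_on (punctured_disc \<times> punctured_disc) F" "\<And>y. y \<in> punctured_disc \<Longrightarrow> (\<lambda>x. F (x, y)) holomorphic_on punctured_disc"
      "\<And>x. x \<in> punctured_disc \<Longrightarrow> (\<lambda>y. F (x, y)) holomorphic_on punctured_disc" for F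
  proof -
    obtain A where "\<And>x y. x \<in> punctured_disc \<Longrightarrow> y \<in> punctured_disc \<Longrightarrow>
        (\<integral>p. F (turn (fst p) * x, turn (snd p) * y) \<partial>(turns \<Otimes>\<^sub>M turns)) = A"
      using torus_mean_const[OF F] by blast
    then show ?thesis
      unfolding mean_def by blast
  qed
  obtain A0 where A0: "mean H A0"
    using mean_ex[of H] contH holHx holHy unfolding punctured_bidisc_def by blast
  have "\<exists>Ap. mean (\<lambda>z. xyprod z * H z) Ap"
  proof (rule mean_ex)
    show "continuous_on (punctured_disc \<times> punctured_disc) (\<lambda>z. xyprod z * H z)"
      using contH unfolding punctured_bidisc_def by (intro continuous_intros)
    show "(\<lambda>x. xyprod (x, y) * H (x, y)) holomorphic_on punctured_disc" if "y \<in> punctured_disc" for y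
      unfolding xyprod_def fst_conv snd_conv by (intro holomorphic_intros holHx that)
    show "(\<lambda>y. xyprod (x, y) * H (x, y)) holomorphic_on punctured_disc" if "x \<in> punctured_disc" for x
      unfolding xyprod_def fst_conv snd_conv by (intro holomorphic_intros holHy that)
  qed
  then obtain Ap where Ap: "mean (\<lambda>z. xyprod z * H z) Ap" ..
  have "\<exists>Am. mean (\<lambda>z. H z / xyprod z) Am"
  proof (rule mean_ex)
    show "continuous_on (punctured_disc \<times> punctured_disc) (\<lambda>z. H z / xyprod z)"
      using contH xyprod_bounds(3) unfolding punctured_bidisc_def by (intro continuous_intros) auto
    show "(\<lambda>x. H (x, y) / xyprod (x, y)) holomorphic_on punctured_disc" if "y \<in> punctured_disc" for y
      unfolding xyprod_def fst_conv snd_conv by (intro holomorphic_intros holHx that) (auto simp: nz that)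
    show "(\<lambda>y. H (x, y) / xyprod (x, y)) holomorphic_on punctured_disc" if "x \<in> punctured_disc" for x
      unfolding xyprod_def fst_conv snd_conv by (intro holomorphic_intros holHy that) (auto simp: nz that)
  qed
  then obtain Am where Am: "mean (\<lambda>z. H z / xyprod z) Am" ..

  have contq: "continuous_on punctured_bidisc (\<lambda>z. 1 / xyprod z)" "continuous_on punctured_bidisc (\<lambda>z. 1 / cnj (xyprod z))"
    "continuous_on punctured_bidisc (\<lambda>z. cnj (xyprod z))"
    using xyprod_bounds(3) by (auto intro!: continuous_intros)
  have qsq: "(of_real (cmod (xyprod z)))\<^sup>2 = xyprod z * cnj (xyprod z)" for z
    by (simp only: of_real_power[symmetric] complex_norm_square)

  \<comment> \<open>Below m is one of 1, 1/cnj q, cnj q and F is H, q H, H/q: the fibre area turns m H into a radial weight times F.\<close>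
  have int_m: "integrable lborel (\<lambda>v. indicator model_domain v * (m (fst v) * h v))"
    and int_w: "integrable lborel (\<lambda>z. of_real (weight k 1 z) * F z)"
    and val: "mean F A \<Longrightarrow>
        (\<integral>v. indicator model_domain v * (m (fst v) * h v) \<partial>lborel) = of_real pi * (A * of_real (moment k 1))"
    if m: "continuous_on punctured_bidisc m" "integrable lborel (\<lambda>v. indicator model_domain v * (cmod (m (fst v)))\<^sup>2)"
      and F: "\<And>z. z \<in> punctured_bidisc \<Longrightarrow> (of_real (cmod (xyprod z)))\<^sup>2 * (m z * H z) = of_real (cmod (xyprod z)) ^ k * F z"
    for m F k A
  proof -
    have eq: "indicator punctured_bidisc z * (of_real (pi * (cmod (xyprod z))\<^sup>2) * (m z * h (z, 0)))
        = of_real pi * (of_real (weight k 1 z) * F z)" for z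
      using F[of z] xyprod_bounds(2)[of z] by (auto simp: indicator_def weight_def H_def mult.assoc)
    note fib = fiber_integral_product[OF cont hw L2 m, unfolded eq]
    show "integrable lborel (\<lambda>v. indicator model_domain v * (m (fst v) * h v))"
      by (rule fib(1))
    show w: "integrable lborel (\<lambda>z. of_real (weight k 1 z) * F z)"
      using integrable_mult_right[OF fib(2), of "1 / of_real pi"] by (simp add: field_simps)
    show "(\<integral>v. indicator model_domain v * (m (fst v) * h v) \<partial>lborel) = of_real pi * (A * of_real (moment k 1))"
      if "mean F A"
      unfolding fib(3) using weight_torus_integral[OF _ w, of A] that by (simp add: mean_def)
  qed
  have q0: "continuous_on punctured_bidisc (\<lambda>z. 1::complex)" by simp
  have i0: "integrable lborel (\<lambda>v. indicator model_domain v * (cmod (1 / cnj (xyprod (fst v))))\<^sup>2)"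
    "integrable lborel (\<lambda>v. indicator model_domain v * (cmod (cnj (xyprod (fst v))))\<^sup>2)"
    using integrable_inverse_square square_integrable_monomials(2) by (simp_all add: norm_divide)
  have e0: "(of_real (cmod (xyprod z)))\<^sup>2 * (1 * H z) = of_real (cmod (xyprod z)) ^ 2 * H z" for z
    by simp
  note T0 = int_m[OF q0 square_integrable_monomials(1) e0] int_w[OF q0 square_integrable_monomials(1) e0]
    val[OF q0 square_integrable_monomials(1) e0 A0]
  have e1: "(of_real (cmod (xyprod z)))\<^sup>2 * (1 / cnj (xyprod z) * H z) = of_real (cmod (xyprod z)) ^ 0 * (xyprod z * H z)"
    if "z \<in> punctured_bidisc" for z
    using xyprod_bounds(3)[OF that] unfolding qsq by simp
  have e2: "(of_real (cmod (xyprod z)))\<^sup>2 * (cnj (xyprod z) * H z) = of_real (cmod (xyprod z)) ^ 4 * (H z / xyprod z)"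
    if "z \<in> punctured_bidisc" for z
  proof -
    have "(of_real (cmod (xyprod z)) :: complex) ^ 4 = (of_real (cmod (xyprod z)))\<^sup>2 * (of_real (cmod (xyprod z)))\<^sup>2"
      by (simp add: power_add[symmetric])
    then show ?thesis
      using xyprod_bounds(3)[OF that] unfolding qsq by simp
  qed
  note T1 = int_m[OF contq(2) i0(1) e1] int_w[OF contq(2) i0(1) e1] val[OF contq(2) i0(1) e1 Ap]
  note T2 = int_m[OF contq(3) i0(2) e2] int_w[OF contq(3) i0(2) e2] val[OF contq(3) i0(2) e2 Am]
  have w3: "integrable lborel (\<lambda>z. of_real (weight 2 1 z) * (H z / xyprod z))"
    by (rule int_w[OF contq(1) integrable_inverse_square]) simp

  define c0 where "c0 = complex_of_real (moment 2 e / (2 * moment 2 1))"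
  define c1 where "c1 = complex_of_real (moment 1 e / (4 * moment 0 1))"
  define c2 where "c2 = complex_of_real (moment 3 e / (4 * moment 4 1))"
  have g: "indicator model_domain v * (cnj (test_projection e (fst v)) * h v)
      = c0 * (indicator model_domain v * (1 * h v)) + c1 * (indicator model_domain v * (1 / cnj (xyprod (fst v)) * h v))
        + c2 * (indicator model_domain v * (cnj (xyprod (fst v)) * h v))" for v
    by (simp add: test_projection_def c0_def c1_def c2_def algebra_simps)
  have c0: "integrable lborel (\<lambda>v. c0 * (indicator model_domain v * (1 * h v)))"
    using T0(1) by (intro integrable_mult_right) auto
  have c1: "integrable lborel (\<lambda>v. c1 * (indicator model_domain v * (1 / cnj (xyprod (fst v)) * h v)))"
    using T1(1) by (intro integrable_mult_right) auto
  have c2: "integrable lborel (\<lambda>v. c2 * (indicator model_domain v * (cnj (xyprod (fst v)) * h v)))"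
    using T2(1) by (intro integrable_mult_right) auto
  show "integrable lborel (\<lambda>v. indicator model_domain v * (cnj (test_projection e (fst v)) * h v))"
    unfolding g by (intro Bochner_Integration.integrable_add c0 c1 c2)
  have rhs: "(\<integral>v. indicator model_domain v * (cnj (test_projection e (fst v)) * h v) \<partial>lborel)
      = c0 * (of_real pi * (A0 * of_real (moment 2 1))) + c1 * (of_real pi * (Ap * of_real (moment 0 1)))
        + c2 * (of_real pi * (Am * of_real (moment 4 1)))"
    unfolding g
    by (subst Bochner_Integration.integral_add, intro Bochner_Integration.integrable_add c0 c1, rule c2,
        subst Bochner_Integration.integral_add, rule c0, rule c1)
      (simp only: integral_mult_right_zero T0(3) T1(3) T2(3) simp_thms)

  have int_h: "integrable lborel (\<lambda>v. indicator model_domain v * (1 * h v))"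
    using T0(1) by auto
  have "integrable lborel (\<lambda>v. indicator (test_set e) v *\<^sub>R (indicator model_domain v * (1 * h v)))"
    using test_set_borel by (intro integrable_mult_indicator int_h) simp
  moreover have "indicator (test_set e) v *\<^sub>R (indicator model_domain v * (1 * h v)) = indicator (test_set e) v * h v" for v
    using test_set_subset by (auto simp: indicator_def)
  ultimately show int_E: "integrable lborel (\<lambda>v. indicator (test_set e) v * h v)"
    by simp

  define r where "r = (\<lambda>z. if cmod (xyprod z) < e then sqrt (((cmod (xyprod z))\<^sup>2 + cmod (xyprod z) * Re (xyprod z)) / 2) else 0)"
  have E: "(z, w) \<in> test_set e \<longleftrightarrow> z \<in> punctured_bidisc \<and> cmod w < r z" for z w
    using test_set_fiber(1)[of z "r z" e w] by (auto simp: r_def test_set_def model_domain_def)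
  have r: "0 \<le> r z" "r z \<le> cmod (xyprod z)" if "z \<in> punctured_bidisc" for z
    using test_set_fiber(2,3)[OF that, of "r z" e] by (auto simp: r_def)
  have holE: "(\<lambda>w. h (z, w)) holomorphic_on ball 0 (r z)" if "z \<in> punctured_bidisc" for z
    using r[OF that] that by (intro holomorphic_on_subset[OF hw]) (auto simp: model_domain_def)
  \<comment> \<open>The three angular modes of the fibre area of the test set.\<close>
  have pw: "indicator punctured_bidisc z * (of_real (pi * (r z)\<^sup>2) * h (z, 0))
      = of_real (pi / 2) * (of_real (weight 2 e z) * H z)
        + of_real (pi / 4) * (of_real (weight 1 e z) * (xyprod z * H z))
        + of_real (pi / 4) * (of_real (weight 3 e z) * (H z / xyprod z))" for z
  proof (cases "z \<in> punctured_bidisc \<and> cmod (xyprod z) < e")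
    case True
    have s: "0 \<le> ((cmod (xyprod z))\<^sup>2 + cmod (xyprod z) * Re (xyprod z)) / 2"
      using r(1)[of z] True by (auto simp: r_def)
    then have rr: "(r z)\<^sup>2 = ((cmod (xyprod z))\<^sup>2 + cmod (xyprod z) * Re (xyprod z)) / 2"
      using True by (simp add: r_def)
    have re: "complex_of_real (Re (xyprod z)) = (xyprod z + cnj (xyprod z)) / 2"
      by (simp add: complex_add_cnj)
    have q3: "complex_of_real (cmod (xyprod z)) ^ 3 / xyprod z = of_real (cmod (xyprod z)) * cnj (xyprod z)"
      using xyprod_bounds(3)[of z] True qsq[of z] by (simp add: power3_eq_cube power2_eq_square field_simps)
    have "of_real (weight 3 e z) * (H z / xyprod z) = (complex_of_real (cmod (xyprod z)) ^ 3 / xyprod z) * H z"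
      using True by (simp add: weight_def)
    also have "\<dots> = of_real (cmod (xyprod z)) * cnj (xyprod z) * H z"
      unfolding q3 ..
    finally have w3: "of_real (weight 3 e z) * (H z / xyprod z) = of_real (cmod (xyprod z)) * cnj (xyprod z) * H z" .
    have w2: "complex_of_real (weight 2 e z) = (of_real (cmod (xyprod z)))\<^sup>2"
      and w1: "complex_of_real (weight 1 e z) = of_real (cmod (xyprod z))"
      using True by (simp_all add: weight_def)
    have "complex_of_real (pi * (r z)\<^sup>2) = of_real pi * of_real ((r z)\<^sup>2)"
      by (rule of_real_mult)
    also have "complex_of_real ((r z)\<^sup>2)
        = ((of_real (cmod (xyprod z)))\<^sup>2 + of_real (cmod (xyprod z)) * ((xyprod z + cnj (xyprod z)) / 2)) / 2"
      unfolding rr re[symmetric] by simp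
    finally have r2: "complex_of_real (pi * (r z)\<^sup>2)
        = of_real pi * (((of_real (cmod (xyprod z)))\<^sup>2 + of_real (cmod (xyprod z)) * ((xyprod z + cnj (xyprod z)) / 2)) / 2)" .
    have "indicator punctured_bidisc z * (of_real (pi * (r z)\<^sup>2) * h (z, 0)) = complex_of_real (pi * (r z)\<^sup>2) * H z"
      using True by (simp add: H_def)
    then show ?thesis
      unfolding w3 w2 w1 r2 by (simp add: field_simps)
  next
    case False
    then show ?thesis by (auto simp: weight_def r_def)
  qed
  have W0: "integrable lborel (\<lambda>z. of_real (weight 2 e z) * H z)"
  proof -
    have "of_real (weight 2 e z) * H z = of_real (weight 0 e z) * (of_real (weight 2 1 z) * H z)" for z
      by (auto simp: weight_def dest: xyprod_bounds)
    then show ?thesis by (simp only: integrable_weight_mult[OF T0(2), of 0 e])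
  qed
  have W1: "integrable lborel (\<lambda>z. of_real (weight 1 e z) * (xyprod z * H z))"
  proof -
    have "of_real (weight 1 e z) * (xyprod z * H z) = of_real (weight 1 e z) * (of_real (weight 0 1 z) * (xyprod z * H z))" for z
      by (auto simp: weight_def dest: xyprod_bounds)
    then show ?thesis by (simp only: integrable_weight_mult[OF T1(2), of 1 e])
  qed
  have W3: "integrable lborel (\<lambda>z. of_real (weight 3 e z) * (H z / xyprod z))"
  proof -
    have "of_real (weight 3 e z) * (H z / xyprod z) = of_real (weight 1 e z) * (of_real (weight 2 1 z) * (H z / xyprod z))" for z
      by (auto simp: weight_def power3_eq_cube power2_eq_square dest: xyprod_bounds)
    then show ?thesis by (simp only: integrable_weight_mult[OF w3, of 1 e])
  qed
  note V = integrable_mult_right[OF W0, of "of_real (pi / 2)"] integrable_mult_right[OF W1, of "of_real (pi / 4)"]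
    integrable_mult_right[OF W3, of "of_real (pi / 4)"]
  have meas: "(\<lambda>z. indicator punctured_bidisc z * (of_real (pi * (r z)\<^sup>2) * h (z, 0))) \<in> borel_measurable lborel"
    unfolding pw by (intro borel_measurable_integrable Bochner_Integration.integrable_add V)
  have "(\<integral>v. indicator (test_set e) v * h v \<partial>lborel)
      = (\<integral>z. indicator punctured_bidisc z * (of_real (pi * (r z)\<^sup>2) * h (z, 0)) \<partial>lborel)"
    by (rule fiber_integral(2)[OF int_E E holE r(1) meas])
  also have "\<dots> = of_real (pi / 2) * (A0 * of_real (moment 2 e)) + of_real (pi / 4) * (Ap * of_real (moment 1 e))
      + of_real (pi / 4) * (Am * of_real (moment 3 e))"
  proof -
    have I: "(\<integral>z. of_real (weight 2 e z) * H z \<partial>lborel) = A0 * of_real (moment 2 e)"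
      "(\<integral>z. of_real (weight 1 e z) * (xyprod z * H z) \<partial>lborel) = Ap * of_real (moment 1 e)"
      "(\<integral>z. of_real (weight 3 e z) * (H z / xyprod z) \<partial>lborel) = Am * of_real (moment 3 e)"
      using weight_torus_integral[OF _ W0, of A0] weight_torus_integral[OF _ W1, of Ap]
        weight_torus_integral[OF _ W3, of Am] A0 Ap Am by (simp_all add: mean_def)
    show ?thesis
      unfolding pw
      by (simp only: Bochner_Integration.integral_add Bochner_Integration.integrable_add V
          integral_mult_right_zero I)
  qed
  also have "\<dots> = (\<integral>v. indicator model_domain v * (cnj (test_projection e (fst v)) * h v) \<partial>lborel)"
    unfolding rhs c0_def c1_def c2_def
    using moment_1_pos[of 0] moment_1_pos[of 2] moment_1_pos[of 4]
    by (simp add: mult_ac)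
  finally show "(\<integral>v. indicator (test_set e) v * h v \<partial>lborel)
      = (\<integral>v. indicator model_domain v * (cnj (test_projection e (fst v)) * h v) \<partial>lborel)" .
qed

section \<open>The model domain as a monomial polyhedron\<close>

definition embed :: "(complex \<times> complex) \<times> complex \<Rightarrow> nat \<Rightarrow> complex" where
  "embed v = (\<lambda>i\<in>{..<3}. if i = 0 then fst (fst v) else if i = 1 then snd (fst v) else snd v)"

definition coords :: "(nat \<Rightarrow> complex) \<Rightarrow> (complex \<times> complex) \<times> complex" where
  "coords z = ((z 0, z 1), z 2)"

definition model_matrix :: "int mat" where
  "model_matrix = mat 3 3 (\<lambda>(i, j). if i = j then 1 else if i = 2 then - 1 else 0)"

lemma coords_embed [simp]: "coords (embed v) = v"
  by (simp add: coords_def embed_def)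

lemma embed_PiE: "embed v \<in> {..<3} \<rightarrow>\<^sub>E UNIV"
  by (simp add: embed_def)

lemma less_3_cases: "(k::nat) < 3 \<longleftrightarrow> k = 0 \<or> k = 1 \<or> k = 2"
  by auto

lemma embed_coords: "z \<in> {..<3} \<rightarrow>\<^sub>E UNIV \<Longrightarrow> embed (coords z) = z"
  by (rule ext) (auto simp: coords_def embed_def less_3_cases restrict_def PiE_def extensional_def)

lemma prod_less_3: "(\<Prod>k<(3::nat). f k) = f 0 * f 1 * f 2"
  by (simp add: numeral_3_eq_3 numeral_2_eq_2)

lemma U_dom_model_matrix:
  "U_dom 3 model_matrix = {z \<in> {..<3} \<rightarrow>\<^sub>E UNIV. coords z \<in> model_domain}"
proof -
  have e: "model_matrix $$ (0, 0) = 1" "model_matrix $$ (0, 1) = 0" "model_matrix $$ (0, 2) = 0"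
    "model_matrix $$ (1, 0) = 0" "model_matrix $$ (1, 1) = 1" "model_matrix $$ (1, 2) = 0"
    "model_matrix $$ (2, 0) = - 1" "model_matrix $$ (2, 1) = - 1" "model_matrix $$ (2, 2) = 1"
    by (simp_all add: model_matrix_def)
  have "(\<forall>j<3. (\<forall>k<3. model_matrix $$ (j, k) < 0 \<longrightarrow> z k \<noteq> 0) \<and>
      (\<Prod>k<3. cmod (z k) powi (model_matrix $$ (j, k))) < 1) \<longleftrightarrow> coords z \<in> model_domain" for z :: "nat \<Rightarrow> complex"
  proof -
    have "(\<forall>j<3. (\<forall>k<3. model_matrix $$ (j, k) < 0 \<longrightarrow> z k \<noteq> 0) \<and>
      (\<Prod>k<3. cmod (z k) powi (model_matrix $$ (j, k))) < 1) \<longleftrightarrow>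
      cmod (z 0) < 1 \<and> cmod (z 1) < 1 \<and> z 0 \<noteq> 0 \<and> z 1 \<noteq> 0 \<and>
      inverse (cmod (z 0)) * inverse (cmod (z 1)) * cmod (z 2) < 1"
      unfolding less_3_cases prod_less_3
      by (auto simp: e[unfolded One_nat_def] e power_int_minus)
    also have "\<dots> \<longleftrightarrow> coords z \<in> model_domain"
      by (auto simp: model_domain_def coords_def punctured_bidisc_def in_punctured_disc xyprod_def norm_mult field_simps)
    finally show ?thesis .
  qed
  then show ?thesis by (simp add: U_dom_def)
qed

lemma U_dom_eq_image: "U_dom 3 model_matrix = embed ` model_domain"
proof (intro equalityI subsetI)
  fix z assume "z \<in> U_dom 3 model_matrix"
  then have "z = embed (coords z)" "coords z \<in> model_domain"
    by (simp_all add: U_dom_model_matrix embed_coords)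
  then show "z \<in> embed ` model_domain" by (rule image_eqI)
next
  fix z assume "z \<in> embed ` model_domain"
  then show "z \<in> U_dom 3 model_matrix"
    using embed_PiE by (auto simp: U_dom_model_matrix)
qed

lemma embed_in_U: "embed v \<in> U_dom 3 model_matrix \<longleftrightarrow> v \<in> model_domain"
  by (simp add: U_dom_model_matrix embed_PiE)

lemma topspace_Cn: "topspace (Cn_top n) = {..<n} \<rightarrow>\<^sub>E UNIV"
  by (simp add: Cn_top_def)

lemma continuous_map_embed: "continuous_map euclidean (Cn_top 3) embed"
  unfolding Cn_top_def continuous_map_componentwise
proof (intro conjI ballI)
  show "embed ` topspace euclidean \<subseteq> extensional {..<3}"
    by (auto simp: embed_def)
  fix k :: nat assume "k \<in> {..<3}"
  then have "k = 0 \<or> k = 1 \<or> k = 2" by (simp add: less_3_cases)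
  then show "continuous_map euclidean euclidean (\<lambda>x. embed x k)"
    by (auto simp: embed_def intro!: continuous_intros)
qed

lemma continuous_map_coords: "continuous_map (Cn_top 3) euclidean coords"
proof -
  have c: "continuous_map (Cn_top 3) euclidean (\<lambda>z. z k)" if "k < 3" for k
    unfolding Cn_top_def using that by (intro continuous_map_product_projection) auto
  have "continuous_map (Cn_top 3) (prod_topology (prod_topology euclidean euclidean) euclidean) coords"
    unfolding coords_def by (intro continuous_map_pairedI c) auto
  then show ?thesis by simp
qed

lemma connected_punctured_disc: "connected punctured_disc"
  unfolding punctured_disc_def
  by (rule connected_punctured_convex) (auto simp: aff_dim_open)

text \<open>
  The model domain is the image of a product of connected sets under \<open>(x, y, u) \<mapsto> (x, y, xyu)\<close>.
\<close>

lemma connected_model_domain: "connected model_domain"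
proof -
  have "model_domain = (\<lambda>v. (fst v, xyprod (fst v) * snd v)) ` (punctured_bidisc \<times> ball 0 1)"
  proof (intro equalityI subsetI)
    fix v assume v: "v \<in> model_domain"
    then have "fst v \<in> punctured_bidisc" "cmod (snd v) < cmod (xyprod (fst v))" by (auto simp: model_domain_def)
    then have "(fst v, snd v / xyprod (fst v)) \<in> punctured_bidisc \<times> ball 0 1" "xyprod (fst v) \<noteq> 0"
      using xyprod_bounds[of "fst v"] by (auto simp: norm_divide)
    then show "v \<in> (\<lambda>v. (fst v, xyprod (fst v) * snd v)) ` (punctured_bidisc \<times> ball 0 1)"
      by (intro image_eqI[of _ _ "(fst v, snd v / xyprod (fst v))"]) auto
  next
    fix v assume "v \<in> (\<lambda>v. (fst v, xyprod (fst v) * snd v)) ` (punctured_bidisc \<times> ball 0 1)"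
    then obtain z u where "z \<in> punctured_bidisc" "cmod u < 1" "v = (z, xyprod z * u)" by auto
    then show "v \<in> model_domain"
      using xyprod_bounds[of z] mult_strict_left_mono[of "cmod u" 1 "cmod (xyprod z)"]
      by (auto simp: model_domain_def norm_mult)
  qed
  moreover have "connected \<dots>"
    by (intro connected_continuous_image continuous_intros connected_Times)
      (auto simp: punctured_bidisc_def connected_punctured_disc connected_Times)
  ultimately show ?thesis by simp
qed

lemma nontrivial_model_matrix: "nontrivial_monomial_polyhedron 3 model_matrix"
proof -
  let ?U = "U_dom 3 model_matrix"
  have "openin (Cn_top 3) ?U"
    using openin_continuous_map_preimage[OF continuous_map_coords, of model_domain] open_model_domain
    by (simp add: U_dom_model_matrix topspace_Cn)
  moreover have "connectedin (Cn_top 3) ?U"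
    unfolding U_dom_eq_image
    using connected_model_domain by (intro connectedin_continuous_map_image[OF continuous_map_embed]) simp
  moreover have "?U \<noteq> {}"
    using embed_in_U[of "((1/2, 1/2), 0)"]
    by (auto simp: model_domain_def punctured_bidisc_def in_punctured_disc xyprod_def)
  moreover have "bounded_Cn 3 ?U"
    unfolding bounded_Cn_def U_dom_model_matrix
  proof (intro exI[of _ 1] ballI allI impI)
    fix z and k :: nat
    assume z: "z \<in> {z \<in> {..<3} \<rightarrow>\<^sub>E UNIV. coords z \<in> model_domain}" and k: "k < 3"
    from z have v: "coords z \<in> model_domain" by simp
    then have "cmod (z 2) < 1"
      using xyprod_bounds(2)[of "fst (coords z)"] by (auto simp: model_domain_def coords_def)
    moreover have "cmod (z 0) < 1" "cmod (z 1) < 1"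
      using v by (simp_all add: model_domain_def coords_def punctured_bidisc_def in_punctured_disc)
    ultimately show "cmod (z k) \<le> 1"
      using k[unfolded less_3_cases] by (elim disjE) simp_all
  qed
  moreover have "model_matrix \<in> carrier_mat 3 3"
    by (simp add: model_matrix_def)
  moreover have "?U \<noteq> unit_polydisc 3"
  proof -
    have "embed ((0, 0), 0) \<in> unit_polydisc 3"
      using embed_PiE[of "((0, 0), 0)"] by (auto simp: unit_polydisc_def embed_def)
    moreover have "embed ((0, 0), 0) \<notin> ?U"
      by (auto simp: embed_in_U model_domain_def punctured_bidisc_def in_punctured_disc)
    ultimately show ?thesis by auto
  qed
  ultimately show ?thesis
    by (simp add: nontrivial_monomial_polyhedron_def monomial_polyhedron_def domain_Cn_def)
qed

lemma det_model_matrix: "Determinant.det model_matrix = 1"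
proof -
  have "Determinant.det model_matrix = prod_list (diag_mat model_matrix)"
    by (rule det_lower_triangular[of 3]) (auto simp: model_matrix_def)
  then show ?thesis
    by (simp add: diag_mat_def model_matrix_def numeral_3_eq_3)
qed

text \<open>
  Since the determinant is 1, the adjugate is the inverse, which is simply exhibited.
\<close>

lemma adj_model_matrix:
  "adj_mat model_matrix = mat 3 3 (\<lambda>(i, j). if i = j \<or> i = 2 then 1 else 0)" (is "_ = ?A")
proof -
  have B: "model_matrix \<in> carrier_mat 3 3" and A: "?A \<in> carrier_mat 3 3"
    by (auto simp: model_matrix_def)
  have BA: "model_matrix * ?A = 1\<^sub>m 3"
    by (rule eq_matI)
      (auto simp: model_matrix_def scalar_prod_def less_3_cases numeral_3_eq_3 atLeast0_lessThan_Suc)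
  have "adj_mat model_matrix = adj_mat model_matrix * (model_matrix * ?A)"
    using adj_mat(1)[OF B] by (simp add: BA)
  also have "\<dots> = (adj_mat model_matrix * model_matrix) * ?A"
    using adj_mat(1)[OF B] A B by (intro assoc_mult_mat[symmetric]) auto
  also have "adj_mat model_matrix * model_matrix = 1\<^sub>m 3"
    unfolding adj_mat(3)[OF B] det_model_matrix by (rule eq_matI) auto
  also have "1\<^sub>m 3 * ?A = ?A"
    using A by simp
  finally show ?thesis .
qed

lemma p_star_model_matrix: "p_star 3 model_matrix = 4 / 3"
proof -
  have s: "(\<Sum>i<3. vec_index (primitive_col model_matrix j) i) = (if j = 2 then 1 else 2)" if j: "j < 3" for j
  proof -
    let ?d = "col (adj_mat model_matrix) j"
    have d: "?d = vec 3 (\<lambda>i. if i = j \<or> i = 2 then 1 else 0)"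
      unfolding adj_model_matrix using j by (intro eq_vecI) auto
    have "1 \<in> set\<^sub>v ?d"
      unfolding d using j by (auto simp: vec_set_def)
    \<comment> \<open>The last entry of every column is 1, so the columns are already primitive.\<close>
    then have "Gcd (set\<^sub>v ?d) = 1"
      by (intro Gcd_eq_1_I[of 1]) auto
    then have "primitive_col model_matrix j = map_vec (\<lambda>x. x div 1) ?d"
      by (simp only: primitive_col_def Let_def)
    also have "\<dots> = ?d"
      by (rule eq_vecI) auto
    finally have "primitive_col model_matrix j = ?d" .
    then show ?thesis
      unfolding d using j by (auto simp: less_3_cases numeral_3_eq_3 numeral_2_eq_2)
  qed
  have "p_star 3 model_matrix = Max ((\<lambda>j. if j = 2 then 1 else 4 / 3) ` {..<3::nat})"
    unfolding p_star_def
    by (intro arg_cong[where f = Max] image_cong refl) (auto simp: s Let_def)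
  also have "(\<lambda>j. if j = 2 then 1 else 4 / 3) ` {..<3::nat} = {1, 4 / 3 :: real}"
    by (auto simp: less_3_cases image_iff intro: bexI[of _ 0] bexI[of _ 2])
  finally show ?thesis by simp
qed

section \<open>Lebesgue measure in coordinates\<close>

interpretation complex_lebesgue: product_sigma_finite "\<lambda>_::nat. lborel :: complex measure" ..

abbreviation lebesgue3 :: "(nat \<Rightarrow> complex) measure" where
  "lebesgue3 \<equiv> PiM {..<3} (\<lambda>_. lborel)"

lemma measurable_embed: "embed \<in> lborel \<rightarrow>\<^sub>M lebesgue3"
  unfolding embed_def
proof (rule measurable_restrict)
  fix i :: nat
  show "(\<lambda>v. if i = 0 then fst (fst v) else if i = 1 then snd (fst v) else snd v) \<in> lborel \<rightarrow>\<^sub>M (lborel :: complex measure)"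
  proof -
    have "(\<lambda>v::(complex \<times> complex) \<times> complex. fst (fst v)) \<in> borel_measurable borel"
      "(\<lambda>v::(complex \<times> complex) \<times> complex. snd (fst v)) \<in> borel_measurable borel"
      "(\<lambda>v::(complex \<times> complex) \<times> complex. snd v) \<in> borel_measurable borel"
      by (intro borel_measurable_continuous_onI continuous_intros)+
    then show ?thesis
      by (cases "i = 0"; cases "i = 1") simp_all
  qed
qed

lemma measurable_coords: "coords \<in> lebesgue3 \<rightarrow>\<^sub>M borel"
proof -
  have c: "(\<lambda>z. z k) \<in> lebesgue3 \<rightarrow>\<^sub>M borel" if "k < 3" for k
    using measurable_component_singleton[of k "{..<3}" "\<lambda>_. lborel :: complex measure"] that by simp
  have "(\<lambda>z. (z 0, z 1)) \<in> lebesgue3 \<rightarrow>\<^sub>M borel \<Otimes>\<^sub>M borel"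
    by (rule measurable_Pair; rule c) simp_all
  then have "(\<lambda>z. (z 0, z 1)) \<in> lebesgue3 \<rightarrow>\<^sub>M borel"
    by (simp only: borel_prod)
  then have "(\<lambda>z. ((z 0, z 1), z 2)) \<in> lebesgue3 \<rightarrow>\<^sub>M borel \<Otimes>\<^sub>M borel"
    by (rule measurable_Pair) (rule c, simp)
  then show ?thesis
    unfolding coords_def by (simp only: borel_prod)
qed

lemma distr_embed: "distr lborel lebesgue3 embed = lebesgue3"
proof (rule complex_lebesgue.PiM_eqI)
  fix A :: "nat \<Rightarrow> complex set"
  assume A: "\<And>i. i \<in> {..<3} \<Longrightarrow> A i \<in> sets lborel"
  have A012: "A 0 \<in> sets borel" "A 1 \<in> sets borel" "A 2 \<in> sets borel"
    using A[of 0] A[of 1] A[of 2] by simp_all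
  have "emeasure (distr lborel lebesgue3 embed) (Pi\<^sub>E {..<3} A) = emeasure lborel (embed -` (Pi\<^sub>E {..<3} A) \<inter> space lborel)"
    by (rule emeasure_distr[OF measurable_embed sets_PiM_I_finite]) (simp, rule A)
  also have "embed -` (Pi\<^sub>E {..<3} A) \<inter> space lborel = (A 0 \<times> A 1) \<times> A 2"
  proof -
    have "embed v \<in> Pi\<^sub>E {..<3} A \<longleftrightarrow> (\<forall>i<3. embed v i \<in> A i)" for v
      using embed_PiE[of v] by (simp add: PiE_iff Ball_def)
    also have "\<And>v. (\<forall>i<3. embed v i \<in> A i) \<longleftrightarrow> embed v 0 \<in> A 0 \<and> embed v 1 \<in> A 1 \<and> embed v 2 \<in> A 2"
      unfolding less_3_cases by blast
    finally have "embed v \<in> Pi\<^sub>E {..<3} A \<longleftrightarrow> fst (fst v) \<in> A 0 \<and> snd (fst v) \<in> A 1 \<and> snd v \<in> A 2" for v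
      by (simp add: embed_def)
    then show ?thesis
      by (simp add: set_eq_iff mem_Times_iff conj_assoc)
  qed
  also have "emeasure lborel ((A 0 \<times> A 1) \<times> A 2) = emeasure lborel (A 0 \<times> A 1) * emeasure lborel (A 2)"
    unfolding lborel_prod[symmetric, where 'a="complex \<times> complex"]
    by (rule lborel.emeasure_pair_measure_Times) (simp_all only: borel_Times A012 sets_lborel)
  also have "emeasure lborel (A 0 \<times> A 1) = emeasure lborel (A 0) * emeasure lborel (A 1)"
    unfolding lborel_prod[symmetric]
    by (rule lborel.emeasure_pair_measure_Times) (simp_all only: A012 sets_lborel)
  also have "emeasure lborel (A 0) * emeasure lborel (A 1) * emeasure lborel (A 2) = (\<Prod>i<3. emeasure lborel (A i))"
    by (simp add: prod_less_3)
  finally show "emeasure (distr lborel lebesgue3 embed) (Pi\<^sub>E {..<3} A) = (\<Prod>i\<in>{..<3}. emeasure lborel (A i))" .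
qed auto

abbreviation U_measure :: "(nat \<Rightarrow> complex) measure" where
  "U_measure \<equiv> Cn_lebesgue_on 3 (U_dom 3 model_matrix)"

lemma space_lebesgue3: "space lebesgue3 = {..<3} \<rightarrow>\<^sub>E UNIV"
  by (simp add: space_PiM)

lemma sets_coords_vimage:
  assumes "S \<in> sets borel"
  shows "{z \<in> {..<3} \<rightarrow>\<^sub>E UNIV. coords z \<in> S} \<in> sets lebesgue3"
proof -
  have "coords -` S \<inter> space lebesgue3 \<in> sets lebesgue3"
    by (rule measurable_sets[OF measurable_coords assms])
  also have "coords -` S \<inter> space lebesgue3 = {z \<in> {..<3} \<rightarrow>\<^sub>E UNIV. coords z \<in> S}"
    unfolding space_lebesgue3 by blast
  finally show ?thesis .
qed

lemma U_dom_sets: "U_dom 3 model_matrix \<in> sets lebesgue3"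
  unfolding U_dom_model_matrix using open_model_domain by (intro sets_coords_vimage) auto

lemma space_U: "space U_measure = U_dom 3 model_matrix"
  using sets.sets_into_space[OF U_dom_sets]
  by (simp add: Cn_lebesgue_on_def Cn_lebesgue_def space_restrict_space Int_absorb2)

lemma U_sets_completion: "U_dom 3 model_matrix \<inter> space (completion lebesgue3) \<in> sets (completion lebesgue3)"
  using U_dom_sets sets.sets_into_space[OF U_dom_sets] by (simp add: Int_absorb2)

lemma model_domain_sets_transport:
  assumes "S \<in> sets borel" "S \<subseteq> model_domain"
  shows "{z \<in> U_dom 3 model_matrix. coords z \<in> S} \<in> sets U_measure"
    and "emeasure U_measure {z \<in> U_dom 3 model_matrix. coords z \<in> S} = emeasure lborel S"
proof -
  let ?A = "{z \<in> U_dom 3 model_matrix. coords z \<in> S}"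
  have A_eq: "?A = {z \<in> {..<3} \<rightarrow>\<^sub>E UNIV. coords z \<in> S}"
    using assms by (auto simp: U_dom_model_matrix)
  have A: "?A \<in> sets lebesgue3"
    unfolding A_eq using assms by (intro sets_coords_vimage)
  show "?A \<in> sets U_measure"
    unfolding Cn_lebesgue_on_def Cn_lebesgue_def
    by (subst sets_restrict_space_iff[OF U_sets_completion]) (use A in auto)
  have "emeasure U_measure ?A = emeasure (completion lebesgue3) ?A"
    unfolding Cn_lebesgue_on_def Cn_lebesgue_def
    by (rule emeasure_restrict_space[OF U_sets_completion]) auto
  also have "\<dots> = emeasure lebesgue3 ?A"
    using A by simp
  also have "\<dots> = emeasure (distr lborel lebesgue3 embed) ?A"
    by (simp only: distr_embed)
  also have "\<dots> = emeasure lborel (embed -` ?A \<inter> space lborel)"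
    by (rule emeasure_distr[OF measurable_embed A])
  also have "embed -` ?A \<inter> space lborel = S"
    using assms by (auto simp: embed_in_U)
  finally show "emeasure U_measure ?A = emeasure lborel S" .
qed

text \<open>
  Borel functions on the domain may be integrated in the coordinates of the model domain: neither the
  completion nor the restriction of the measure affects their integrals.
\<close>

lemma model_domain_transport:
  fixes f :: "(nat \<Rightarrow> complex) \<Rightarrow> 'b::{banach, second_countable_topology}"
  assumes f: "(\<lambda>v. indicator model_domain v *\<^sub>R f (embed v)) \<in> borel_measurable borel"
  shows "f \<in> borel_measurable U_measure"
    and "integrable U_measure f \<longleftrightarrow> integrable lborel (\<lambda>v. indicator model_domain v *\<^sub>R f (embed v))"
    and "integral\<^sup>L U_measure f = (\<integral>v. indicator model_domain v *\<^sub>R f (embed v) \<partial>lborel)"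
proof -
  let ?U = "U_dom 3 model_matrix" and ?G = "\<lambda>v. indicator model_domain v *\<^sub>R f (embed v)"
  have G: "indicator ?U z *\<^sub>R f z = ?G (coords z)" if "z \<in> space lebesgue3" for z
    using that embed_coords[of z] by (auto simp: space_lebesgue3 U_dom_model_matrix indicator_def)
  have F: "(\<lambda>z. indicator ?U z *\<^sub>R f z) \<in> borel_measurable lebesgue3"
    using measurable_compose[OF measurable_coords f] by (subst measurable_cong[OF G])
  then have Fc: "(\<lambda>z. indicator ?U z *\<^sub>R f z) \<in> borel_measurable (completion lebesgue3)"
    by (rule measurable_completion)
  then show "f \<in> borel_measurable U_measure"
    unfolding Cn_lebesgue_on_def Cn_lebesgue_def
    by (subst borel_measurable_restrict_space_iff[OF U_sets_completion])
  have FG: "indicator ?U (embed v) *\<^sub>R f (embed v) = ?G v" for v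
    by (simp add: indicator_def embed_in_U)
  have "integrable U_measure f \<longleftrightarrow> integrable (completion lebesgue3) (\<lambda>z. indicator ?U z *\<^sub>R f z)"
    unfolding Cn_lebesgue_on_def Cn_lebesgue_def by (rule integrable_restrict_space[OF U_sets_completion])
  also have "\<dots> \<longleftrightarrow> integrable lebesgue3 (\<lambda>z. indicator ?U z *\<^sub>R f z)"
    by (rule integrable_completion[OF F])
  also have "\<dots> \<longleftrightarrow> integrable (distr lborel lebesgue3 embed) (\<lambda>z. indicator ?U z *\<^sub>R f z)"
    by (simp only: distr_embed)
  also have "\<dots> \<longleftrightarrow> integrable lborel ?G"
    unfolding integrable_distr_eq[OF measurable_embed F] FG ..
  finally show "integrable U_measure f \<longleftrightarrow> integrable lborel ?G" .
  have "integral\<^sup>L U_measure f = integral\<^sup>L (completion lebesgue3) (\<lambda>z. indicator ?U z *\<^sub>R f z)"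
    unfolding Cn_lebesgue_on_def Cn_lebesgue_def by (rule integral_restrict_space[OF U_sets_completion])
  also have "\<dots> = integral\<^sup>L lebesgue3 (\<lambda>z. indicator ?U z *\<^sub>R f z)"
    by (rule integral_completion[OF F])
  also have "\<dots> = integral\<^sup>L (distr lborel lebesgue3 embed) (\<lambda>z. indicator ?U z *\<^sub>R f z)"
    by (simp only: distr_embed)
  also have "\<dots> = integral\<^sup>L lborel ?G"
    unfolding integral_distr[OF measurable_embed F] FG ..
  finally show "integral\<^sup>L U_measure f = integral\<^sup>L lborel ?G" .
qed

section \<open>The Bergman projection\<close>

lemma holomorphic_Cn_diff:
  assumes "holomorphic_Cn n \<Omega> f" "holomorphic_Cn n \<Omega> g"
  shows "holomorphic_Cn n \<Omega> (\<lambda>z. f z - g z)"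
  using assms unfolding holomorphic_Cn_def
  by (auto intro!: continuous_map_diff holomorphic_on_diff)

lemma L2_space_diff:
  assumes f: "f \<in> L2_space M" and g: "g \<in> L2_space M"
  shows "(\<lambda>x. f x - g x) \<in> L2_space M"
proof -
  have m [measurable]: "f \<in> borel_measurable M" "g \<in> borel_measurable M"
    and i: "integrable M (\<lambda>x. (cmod (f x))\<^sup>2)" "integrable M (\<lambda>x. (cmod (g x))\<^sup>2)"
    using f g by (auto simp: L2_space_def)
  have "integrable M (\<lambda>x. (cmod (f x - g x))\<^sup>2)"
  proof (rule Bochner_Integration.integrable_bound)
    show "integrable M (\<lambda>x. 2 * (cmod (f x))\<^sup>2 + 2 * (cmod (g x))\<^sup>2)"
      using i by simp
    show "(\<lambda>x. (cmod (f x - g x))\<^sup>2) \<in> borel_measurable M"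
      by measurable
    have "(cmod (f x - g x))\<^sup>2 \<le> 2 * (cmod (f x))\<^sup>2 + 2 * (cmod (g x))\<^sup>2" for x
    proof -
      have "(cmod (f x - g x))\<^sup>2 \<le> (cmod (f x) + cmod (g x))\<^sup>2"
        by (intro power_mono norm_triangle_ineq4) simp
      also have "\<dots> \<le> 2 * (cmod (f x))\<^sup>2 + 2 * (cmod (g x))\<^sup>2"
        using sum_squares_bound[of "cmod (f x)" "cmod (g x)"] by (simp add: power2_sum)
      finally show ?thesis .
    qed
    then show "AE x in M. norm ((cmod (f x - g x))\<^sup>2) \<le> norm (2 * (cmod (f x))\<^sup>2 + 2 * (cmod (g x))\<^sup>2)"
      by simp
  qed
  then show ?thesis
    using m by (simp add: L2_space_def)
qed

lemma borel_measurable_cnj: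
  assumes "f \<in> borel_measurable M"
  shows "(\<lambda>x. cnj (f x)) \<in> borel_measurable M"
  by (rule borel_measurable_continuous_on[OF _ assms]) (intro continuous_intros)

lemma integrable_L2_inner:
  assumes "f \<in> L2_space M" "g \<in> L2_space M"
  shows "integrable M (\<lambda>x. f x * cnj (g x))"
  using assms unfolding L2_space_def by (intro integrable_L2_product borel_measurable_cnj) auto

text \<open>
  Two functions of the Bergman space with the same orthogonality relations have a
  difference that is orthogonal to itself, so they agree almost everywhere; this
  applies to the function chosen by the definition of the projection.
\<close>

lemma bergman_projection_unique:
  fixes n :: nat and \<Omega> :: "(nat \<Rightarrow> complex) set"
  defines "M \<equiv> Cn_lebesgue_on n \<Omega>"
  assumes f: "f \<in> L2_space M" and g: "g \<in> bergman_space n \<Omega>"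
    and orth: "\<And>h. h \<in> bergman_space n \<Omega> \<Longrightarrow> L2_inner M (\<lambda>z. f z - g z) h = 0"
  shows "bergman_projection n \<Omega> f \<in> borel_measurable M"
    and "AE z in M. bergman_projection n \<Omega> f z = g z"
proof -
  define p where "p = bergman_projection n \<Omega> f"
  have "p \<in> bergman_space n \<Omega> \<and> (\<forall>h\<in>bergman_space n \<Omega>. L2_inner M (\<lambda>z. f z - p z) h = 0)"
    unfolding p_def bergman_projection_def M_def
    by (rule someI[of _ g]) (use g orth in \<open>auto simp: M_def\<close>)
  then have p: "p \<in> bergman_space n \<Omega>"
    and p_orth: "\<And>h. h \<in> bergman_space n \<Omega> \<Longrightarrow> L2_inner M (\<lambda>z. f z - p z) h = 0"
    by auto
  have pL: "p \<in> L2_space M" and gL: "g \<in> L2_space M"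
    using p g by (auto simp: bergman_space_def M_def)
  define k where "k = (\<lambda>z. g z - p z)"
  have k: "k \<in> bergman_space n \<Omega>"
    using p g unfolding k_def bergman_space_def by (auto intro!: L2_space_diff holomorphic_Cn_diff)
  have kL: "k \<in> L2_space M"
    unfolding k_def by (intro L2_space_diff pL gL)
  have "(LINT z|M. k z * cnj (k z)) = (LINT z|M. (f z - p z) * cnj (k z) - (f z - g z) * cnj (k z))"
    by (intro Bochner_Integration.integral_cong refl) (simp add: k_def algebra_simps)
  also have "\<dots> = L2_inner M (\<lambda>z. f z - p z) k - L2_inner M (\<lambda>z. f z - g z) k"
    unfolding L2_inner_def
    by (intro Bochner_Integration.integral_diff integrable_L2_inner L2_space_diff f pL gL kL)
  also have "\<dots> = 0"
    using p_orth[OF k] orth[OF k] by simp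
  finally have "(LINT z|M. complex_of_real ((cmod (k z))\<^sup>2)) = 0"
    by (simp only: complex_norm_square)
  then have "complex_of_real (LINT z|M. (cmod (k z))\<^sup>2) = 0"
    by (simp only: integral_complex_of_real)
  then have "(LINT z|M. (cmod (k z))\<^sup>2) = 0"
    by (simp only: of_real_eq_0_iff)
  moreover have "integrable M (\<lambda>z. (cmod (k z))\<^sup>2)"
    using kL by (simp add: L2_space_def)
  ultimately have "AE z in M. (cmod (k z))\<^sup>2 = 0"
    using integral_nonneg_eq_0_iff_AE[of M "\<lambda>z. (cmod (k z))\<^sup>2"] by simp
  then show "AE z in M. bergman_projection n \<Omega> f z = g z"
    by eventually_elim (simp add: k_def p_def)
  show "bergman_projection n \<Omega> f \<in> borel_measurable M"
    using pL by (simp add: p_def L2_space_def)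
qed

lemma embed_upd:
  "(embed ((x, y), w))(0 := a) = embed ((a, y), w)"
  "(embed ((x, y), w))(1 := a) = embed ((x, a), w)"
  "(embed ((x, y), w))(2 := a) = embed ((x, y), a)"
  by (auto simp: embed_def restrict_def fun_eq_iff)

text \<open>
  Elements of the Bergman space, read in coordinates, satisfy the hypotheses of \<open>bergman_identity\<close>.
\<close>

lemma bergman_space_coordinates:
  assumes h: "h \<in> bergman_space 3 (U_dom 3 model_matrix)"
  defines "k \<equiv> \<lambda>v. h (embed v)"
  shows "continuous_on model_domain k"
    and "\<And>y w. (\<lambda>x. k ((x, y), w)) holomorphic_on {x. ((x, y), w) \<in> model_domain}"
    and "\<And>x w. (\<lambda>y. k ((x, y), w)) holomorphic_on {y. ((x, y), w) \<in> model_domain}"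
    and "\<And>z. (\<lambda>w. k (z, w)) holomorphic_on {w. (z, w) \<in> model_domain}"
    and "integrable lborel (\<lambda>v. indicator model_domain v * (cmod (k v))\<^sup>2)"
proof -
  let ?U = "U_dom 3 model_matrix"
  have hol: "\<And>z k. z \<in> ?U \<Longrightarrow> k < 3 \<Longrightarrow> (\<lambda>w. h (z(k := w))) holomorphic_on {w. z(k := w) \<in> ?U}"
    and cont: "continuous_map (subtopology (Cn_top 3) ?U) euclidean h"
    using h by (auto simp: bergman_space_def holomorphic_Cn_def)
  have "continuous_map (top_of_set model_domain) (subtopology (Cn_top 3) ?U) embed"
    using continuous_map_from_subtopology[OF continuous_map_embed]
    by (auto simp: continuous_map_in_subtopology embed_in_U)
  from continuous_map_compose[OF this cont] show c: "continuous_on model_domain k"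
    by (simp add: k_def comp_def)
  have "(\<lambda>a. k ((a, y), w)) holomorphic_on {a. ((a, y), w) \<in> model_domain}" if "((x, y), w) \<in> model_domain" for x y w
    using hol[of "embed ((x, y), w)" 0] that by (simp only: embed_upd embed_in_U k_def)
  then show "(\<lambda>x. k ((x, y), w)) holomorphic_on {x. ((x, y), w) \<in> model_domain}" for y w
    by (cases "\<exists>x. ((x, y), w) \<in> model_domain") (auto intro: holomorphic_on_empty)
  have "(\<lambda>a. k ((x, a), w)) holomorphic_on {a. ((x, a), w) \<in> model_domain}" if "((x, y), w) \<in> model_domain" for x y w
    using hol[of "embed ((x, y), w)" 1] that by (simp only: embed_upd embed_in_U k_def)
  then show "(\<lambda>y. k ((x, y), w)) holomorphic_on {y. ((x, y), w) \<in> model_domain}" for x w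
    by (cases "\<exists>y. ((x, y), w) \<in> model_domain") (auto intro: holomorphic_on_empty)
  have "(\<lambda>a. k ((x, y), a)) holomorphic_on {a. ((x, y), a) \<in> model_domain}" if "((x, y), w) \<in> model_domain" for x y w
    using hol[of "embed ((x, y), w)" 2] that by (simp only: embed_upd embed_in_U k_def)
  then show "(\<lambda>w. k (z, w)) holomorphic_on {w. (z, w) \<in> model_domain}" for z
    by (cases z; cases "\<exists>w. (z, w) \<in> model_domain") (auto intro: holomorphic_on_empty)
  have "(\<lambda>v. indicator model_domain v *\<^sub>R (cmod (h (embed v)))\<^sup>2) \<in> borel_measurable borel"
    using c[unfolded k_def] open_model_domain
    by (intro borel_measurable_continuous_on_indicator continuous_intros) auto
  from model_domain_transport(2)[OF this] show "integrable lborel (\<lambda>v. indicator model_domain v * (cmod (k v))\<^sup>2)"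
    using h by (simp add: bergman_space_def L2_space_def k_def)
qed

definition test_projection_Cn :: "real \<Rightarrow> (nat \<Rightarrow> complex) \<Rightarrow> complex" where
  "test_projection_Cn e z = test_projection e (fst (coords z))"

lemma continuous_test_projection: "continuous_on punctured_bidisc (test_projection e)"
  unfolding test_projection_def by (intro continuous_intros) (auto dest: xyprod_bounds)

text \<open>
  On the domain \<open>\<bar>q\<bar> < 1\<close>, so all three terms are bounded by a multiple of \<open>1/\<bar>q\<bar>\<close>.
\<close>

lemma test_projection_square_integrable:
  "integrable lborel (\<lambda>v. indicator model_domain v * (cmod (test_projection e (fst v)))\<^sup>2)"
proof (rule Bochner_Integration.integrable_bound)
  define c where "c = \<bar>moment 2 e / (2 * moment 2 1)\<bar> + \<bar>moment 1 e / (4 * moment 0 1)\<bar>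
    + \<bar>moment 3 e / (4 * moment 4 1)\<bar>"
  show "integrable lborel (\<lambda>v. c\<^sup>2 * (indicator model_domain v * (cmod (1 / xyprod (fst v)))\<^sup>2))"
    by (intro integrable_mult_right integrable_inverse_square)
  have "(\<lambda>v. indicator model_domain v *\<^sub>R (cmod (test_projection e (fst v)))\<^sup>2) \<in> borel_measurable borel"
    using open_model_domain
    by (intro borel_measurable_continuous_on_indicator continuous_intros
        continuous_on_compose2[OF continuous_test_projection]) (auto simp: model_domain_def)
  then show "(\<lambda>v. indicator model_domain v * (cmod (test_projection e (fst v)))\<^sup>2) \<in> borel_measurable lborel"
    by simp
  have "cmod (test_projection e z) \<le> c * cmod (1 / xyprod z)" if z: "z \<in> punctured_bidisc" for z
  proof -
    let ?q = "cmod (xyprod z)"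
    have q: "0 < ?q" "?q < 1" using xyprod_bounds[OF z] by simp_all
    have q1: "1 \<le> 1 / ?q" using q by simp
    have "?q \<le> 1 / ?q" using q q1 by linarith
    have "cmod (test_projection e z) \<le> \<bar>moment 2 e / (2 * moment 2 1)\<bar> * 1
        + \<bar>moment 1 e / (4 * moment 0 1)\<bar> * (1 / ?q) + \<bar>moment 3 e / (4 * moment 4 1)\<bar> * ?q"
      unfolding test_projection_def
      by (intro order_trans[OF norm_triangle_ineq] add_mono) (simp_all only: norm_mult norm_divide norm_of_real mult_1_right order_refl times_divide_eq_right)
    also have "\<dots> \<le> c * (1 / ?q)"
      unfolding c_def distrib_right
      by (intro add_mono mult_left_mono q1 \<open>?q \<le> 1 / ?q\<close> order_refl abs_ge_zero)
    finally show ?thesis by (simp add: norm_divide)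
  qed
  then have "(cmod (test_projection e z))\<^sup>2 \<le> c\<^sup>2 * (cmod (1 / xyprod z))\<^sup>2" if "z \<in> punctured_bidisc" for z
    using power_mono[of "cmod (test_projection e z)" "c * cmod (1 / xyprod z)" 2] that by (simp only: power_mult_distrib norm_ge_zero)
  then show "AE v in lborel. norm (indicator model_domain v * (cmod (test_projection e (fst v)))\<^sup>2)
      \<le> norm (c\<^sup>2 * (indicator model_domain v * (cmod (1 / xyprod (fst v)))\<^sup>2))"
    by (intro AE_I2) (auto simp: indicator_def model_domain_def)
qed

lemma test_projection_Cn_in_bergman_space: "test_projection_Cn e \<in> bergman_space 3 (U_dom 3 model_matrix)"
proof -
  let ?U = "U_dom 3 model_matrix"
  have meas: "(\<lambda>v. indicator model_domain v *\<^sub>R test_projection_Cn e (embed v)) \<in> borel_measurable borel"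
    unfolding test_projection_Cn_def coords_embed using open_model_domain
    by (intro borel_measurable_continuous_on_indicator continuous_intros
        continuous_on_compose2[OF continuous_test_projection]) (auto simp: model_domain_def)
  have meas2: "(\<lambda>v. indicator model_domain v *\<^sub>R (cmod (test_projection_Cn e (embed v)))\<^sup>2) \<in> borel_measurable borel"
    unfolding test_projection_Cn_def coords_embed using open_model_domain
    by (intro borel_measurable_continuous_on_indicator continuous_intros
        continuous_on_compose2[OF continuous_test_projection]) (auto simp: model_domain_def)
  have "test_projection_Cn e \<in> L2_space U_measure"
    unfolding L2_space_def using model_domain_transport(1)[OF meas] model_domain_transport(2)[OF meas2] test_projection_square_integrable
    by (simp add: test_projection_Cn_def[abs_def])
  moreover have "continuous_map (subtopology (Cn_top 3) ?U) euclidean (test_projection_Cn e)"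
  proof -
    have "continuous_map (subtopology (Cn_top 3) ?U) (top_of_set model_domain) coords"
      using continuous_map_from_subtopology[OF continuous_map_coords, of ?U]
      by (auto simp: continuous_map_in_subtopology U_dom_model_matrix)
    moreover have "continuous_map (top_of_set model_domain) euclidean (\<lambda>v. test_projection e (fst v))"
      unfolding continuous_map_iff_continuous
      by (intro continuous_on_compose2[OF continuous_test_projection] continuous_intros) (auto simp: model_domain_def)
    ultimately have "continuous_map (subtopology (Cn_top 3) ?U) euclidean ((\<lambda>v. test_projection e (fst v)) \<circ> coords)"
      by (rule continuous_map_compose)
    then show ?thesis by (simp add: comp_def test_projection_Cn_def[abs_def])
  qed
  moreover have "(\<lambda>w. test_projection_Cn e (z(k := w))) holomorphic_on {w. z(k := w) \<in> ?U}" if "k < 3" for z k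
  proof -
    have nz: "xyprod (fst (coords (z(k := w)))) \<noteq> 0" if "z(k := w) \<in> ?U" for w
      using that xyprod_bounds(3) by (auto simp: U_dom_model_matrix model_domain_def)
    have hq: "(\<lambda>w. xyprod (fst (coords (z(k := w))))) holomorphic_on S" for S
      using that unfolding less_3_cases
      by (elim disjE) (auto simp: xyprod_def coords_def intro!: holomorphic_intros)
    show ?thesis
      unfolding test_projection_Cn_def test_projection_def by (intro holomorphic_intros hq) (use nz in auto)
  qed
  ultimately show ?thesis
    by (simp add: bergman_space_def holomorphic_Cn_def)
qed

definition test_set_Cn :: "real \<Rightarrow> (nat \<Rightarrow> complex) set" where
  "test_set_Cn e = {z \<in> U_dom 3 model_matrix. coords z \<in> test_set e}"

lemma test_set_Cn_sets: "test_set_Cn e \<in> sets U_measure"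
  and emeasure_test_set_Cn: "emeasure U_measure (test_set_Cn e) = emeasure lborel (test_set e)"
  unfolding test_set_Cn_def using model_domain_sets_transport[OF test_set_borel test_set_subset] by auto

lemma emeasure_test_set_finite: "emeasure lborel (test_set e) < \<infinity>"
  using emeasure_test_set_le[of e] by (rule le_less_trans) simp

lemma test_projection_Cn_orthogonal:
  assumes h: "h \<in> bergman_space 3 (U_dom 3 model_matrix)"
  shows "L2_inner U_measure (\<lambda>z. indicator (test_set_Cn e) z - test_projection_Cn e z) h = 0"
proof -
  note id = bergman_identity[where h = "\<lambda>v. h (embed v)" and e = e, OF bergman_space_coordinates[OF h]]
  have ind: "indicator model_domain v *\<^sub>R ((indicator (test_set_Cn e) (embed v) - test_projection_Cn e (embed v)) * cnj (h (embed v)))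
     = cnj (indicator (test_set e) v * h (embed v) - indicator model_domain v * (cnj (test_projection e (fst v)) * h (embed v)))" for v
    using test_set_subset[of e]
    by (auto simp: indicator_def test_set_Cn_def embed_in_U test_projection_Cn_def algebra_simps)
  have "(\<lambda>v. indicator model_domain v *\<^sub>R ((indicator (test_set_Cn e) (embed v) - test_projection_Cn e (embed v)) * cnj (h (embed v))))
      \<in> borel_measurable borel"
    unfolding ind using borel_measurable_integrable[OF Bochner_Integration.integrable_diff[OF id(1,2)]]
    by (intro borel_measurable_cnj) simp
  from model_domain_transport(3)[OF this]
  have "L2_inner U_measure (\<lambda>z. indicator (test_set_Cn e) z - test_projection_Cn e z) h
    = cnj (\<integral>v. indicator (test_set e) v * h (embed v) - indicator model_domain v * (cnj (test_projection e (fst v)) * h (embed v)) \<partial>lborel)"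
    unfolding L2_inner_def ind by (simp only: Bochner_Integration.integral_cnj)
  also have "\<dots> = 0"
    using id(3) by (simp add: Bochner_Integration.integral_diff[OF id(1,2)])
  finally show ?thesis .
qed

theorem theorem1p4:
  shows "\<exists>(n::nat) (B::int mat).
    nontrivial_monomial_polyhedron n B \<and> Determinant.det B > 0 \<and>
    \<not> restricted_weak_type (Cn_lebesgue_on n (U_dom n B)) (p_star n B)
        (bergman_projection n (U_dom n B))"
proof (intro exI conjI)
  show "nontrivial_monomial_polyhedron 3 model_matrix"
    by (rule nontrivial_model_matrix)
  show "Determinant.det model_matrix > 0"
    by (simp add: det_model_matrix)
  show "\<not> restricted_weak_type U_measure (p_star 3 model_matrix) (bergman_projection 3 (U_dom 3 model_matrix))"
  proof
    assume "restricted_weak_type U_measure (p_star 3 model_matrix) (bergman_projection 3 (U_dom 3 model_matrix))"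
    then obtain C where C: "C > 0" and weak: "\<And>E y. E \<in> sets U_measure \<Longrightarrow> emeasure U_measure E < \<infinity> \<Longrightarrow> y > 0 \<Longrightarrow>
        emeasure U_measure {z \<in> space U_measure. cmod (bergman_projection 3 (U_dom 3 model_matrix) (indicator E) z) > y}
          \<le> ennreal (C powr (4 / 3) / y powr (4 / 3)) * emeasure U_measure E"
      unfolding restricted_weak_type_def p_star_model_matrix by auto
    define V where "V = measure lborel model_domain"
    have fin: "emeasure lborel model_domain < \<infinity>"
      using emeasure_bounded_finite[OF bounded_model_domain] by simp
    have V: "emeasure lborel model_domain = ennreal V"
      unfolding V_def using fin by (intro emeasure_eq_ennreal_measure) (simp add: less_top[symmetric])
    have V0: "V > 0"
    proof -
      have "((1/2, 1/2), 0) \<in> model_domain"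
        by (simp add: zero_in_model_domain punctured_bidisc_def in_punctured_disc)
      then obtain r where r: "r > 0" "ball ((1/2, 1/2), 0) r \<subseteq> model_domain"
        using open_model_domain open_contains_ball by blast
      have "0 < measure lborel (ball (((1/2, 1/2), 0) :: (complex \<times> complex) \<times> complex) r)"
        by (rule content_ball_pos[OF r(1)])
      also have "\<dots> \<le> V"
        unfolding V_def using r(2) open_model_domain fin
        by (intro measure_mono_fmeasurable) (auto simp: fmeasurable_def)
      finally show ?thesis .
    qed
    obtain e y where y: "0 < y" and big: "\<And>z. z \<in> punctured_bidisc \<Longrightarrow> y < cmod (test_projection e z)"
      and small: "C powr (4 / 3) * (pi * moment 2 e) < V * y powr (4 / 3)"
      by (rule weak_type_bound_violated[OF _ V0, of "C powr (4 / 3)"]) (use C in simp, blast)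
    let ?f = "indicator (test_set_Cn e) :: (nat \<Rightarrow> complex) \<Rightarrow> complex"
    let ?P = "bergman_projection 3 (U_dom 3 model_matrix) ?f"
    have f: "?f \<in> L2_space U_measure"
    proof -
      have "integrable U_measure (indicator (test_set_Cn e) :: _ \<Rightarrow> real)"
        using test_set_Cn_sets emeasure_test_set_Cn emeasure_test_set_finite by simp
      moreover have "(\<lambda>z. (cmod (?f z))\<^sup>2) = indicator (test_set_Cn e)"
        by (auto simp: fun_eq_iff indicator_def)
      ultimately show ?thesis
        using test_set_Cn_sets by (simp add: L2_space_def)
    qed
    have P: "?P \<in> borel_measurable U_measure" "AE z in U_measure. ?P z = test_projection_Cn e z"
      by (rule bergman_projection_unique[OF f test_projection_Cn_in_bergman_space test_projection_Cn_orthogonal]; assumption)+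
    let ?S = "{z \<in> space U_measure. cmod (?P z) > y}"
    have S: "?S \<in> sets U_measure"
      using P(1) by measurable
    have "AE z in U_measure. z \<in> ?S \<longleftrightarrow> z \<in> space U_measure"
    proof -
      have "AE z in U_measure. z \<in> space U_measure"
        by (rule AE_space)
      then show ?thesis
        using P(2)
      proof eventually_elim
        case (elim z)
        then have "z \<in> U_dom 3 model_matrix"
          by (simp add: space_U)
        then have "fst (coords z) \<in> punctured_bidisc"
          by (simp add: U_dom_model_matrix model_domain_def)
        then show ?case
          using big elim by (simp add: test_projection_Cn_def)
      qed
    qed
    then have "emeasure U_measure ?S = emeasure U_measure (space U_measure)"
      by (rule emeasure_eq_AE[OF _ S]) simp
    moreover have "space U_measure = {z \<in> U_dom 3 model_matrix. coords z \<in> model_domain}"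
      unfolding space_U unfolding U_dom_model_matrix by blast
    moreover have "emeasure U_measure {z \<in> U_dom 3 model_matrix. coords z \<in> model_domain} = ennreal V"
      using model_domain_sets_transport(2)[of model_domain] open_model_domain V by simp
    ultimately have SV: "emeasure U_measure ?S = ennreal V"
      by (simp only:)
    have "emeasure U_measure ?S
        \<le> ennreal (C powr (4 / 3) / y powr (4 / 3)) * emeasure U_measure (test_set_Cn e)"
      by (rule weak[OF test_set_Cn_sets _ y]) (simp only: emeasure_test_set_Cn emeasure_test_set_finite)
    then have "ennreal V \<le> ennreal (C powr (4 / 3) / y powr (4 / 3)) * emeasure lborel (test_set e)"
      unfolding SV emeasure_test_set_Cn .
    also have "\<dots> \<le> ennreal (C powr (4 / 3) / y powr (4 / 3)) * ennreal (pi * moment 2 e)"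
      by (intro mult_left_mono emeasure_test_set_le) simp
    also have "\<dots> = ennreal (C powr (4 / 3) / y powr (4 / 3) * (pi * moment 2 e))"
      by (rule ennreal_mult'[symmetric]) simp
    finally have "V \<le> C powr (4 / 3) / y powr (4 / 3) * (pi * moment 2 e)"
      using V0 by (simp add: ennreal_le_iff2)
    then have "V * y powr (4 / 3) \<le> C powr (4 / 3) * (pi * moment 2 e)"
      using y by (simp add: field_simps)
    then show False using small by simp
  qed
qed

end
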